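(* There exist convex bodies $W_n\in\mathcal{K}_n$ such that, as $n\to\infty$, $$d(g(W_n),l(W_n))=1-\frac1n\left(4+\frac{2e}{(e-1)\left(1-\sqrt{\frac{2}{\pi}}\right)}\right)+o\left(\frac1n\right).$$
   Context: A convex body is a compact convex subset of $\mathbb{R}^n$ with non-empty interior; $\mathcal{K}_n$ is the set of all convex bodies in $\mathbb{R}^n$. For $K\in\mathcal{K}_n$, $g(K)=\frac{1}{\mathrm{vol}_n(K)}\int_K x\,dx$ is the centroid of $K$ and $l(K)$ is the center of the L\"owner ellipsoid of $K$ (the unique ellipsoid of minimal volume containing $K$). For two points $p_1(K),p_2(K)\in K$, set $d(p_1(K),p_2(K))=0$ if $p_1(K)=p_2(K)$, and otherwise $$d(p_1(K),p_2(K))=\frac{\|p_1(K)-p_2(K)\|}{\mathrm{vol}_1(\ell\cap K)},$$ where $\ell$ is the line through $p_1(K)$ and $p_2(K)$, $\|\cdot\|$ is the Euclidean norm and $\mathrm{vol}_1$ is length. *)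

theory Defs
  imports "HOL-Analysis.Analysis" "HOL-Library.Function_Algebras" "HOL-Library.Landau_Symbols"
begin

text \<open>
  The dimension varies within the statement, so $\mathbb{R}^n$ is modelled as the library's
  \<^const>\<open>Euclidean_space\<close>: the sequences of type \<^typ>\<open>nat \<Rightarrow> real\<close> that vanish at all indices
  \<open>\<ge> n\<close>. Pointwise scaling makes \<^const>\<open>convex\<close>, \<^const>\<open>linear\<close> and
  \<^const>\<open>hull\<close> applicable to them.
\<close>

instantiation "fun" :: (type, real_vector) real_vector
begin

definition scaleR_fun :: "real \<Rightarrow> ('a \<Rightarrow> 'b) \<Rightarrow> 'a \<Rightarrow> 'b"
  where "scaleR_fun r f = (\<lambda>x. r *\<^sub>R f x)"

instance
  by standard (auto simp: scaleR_fun_def fun_eq_iff algebra_simps)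

end

abbreviation Rn :: "nat \<Rightarrow> (nat \<Rightarrow> real) set"
  where "Rn n \<equiv> topspace (Euclidean_space n)"

definition euclidean_norm :: "nat \<Rightarrow> (nat \<Rightarrow> real) \<Rightarrow> real"
  where "euclidean_norm n x = L2_set x {..<n}"

text \<open>
  The product measure lives on functions that are \<^const>\<open>undefined\<close> outside \<open>{..<n}\<close>; it is
  transported to \<^term>\<open>Rn n\<close> by replacing these values by \<open>0\<close>.
\<close>

definition lebesgue_Rn :: "nat \<Rightarrow> (nat \<Rightarrow> real) measure"
  where "lebesgue_Rn n =
    distr (Pi\<^sub>M {..<n} (\<lambda>_. lborel)) borel (\<lambda>x i. if i < n then x i else 0)"

definition convex_bodies :: "nat \<Rightarrow> (nat \<Rightarrow> real) set set"
  where "convex_bodies n =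
    {K. compactin (Euclidean_space n) K \<and> convex K \<and> (Euclidean_space n) interior_of K \<noteq> {}}"

definition centroid :: "nat \<Rightarrow> (nat \<Rightarrow> real) set \<Rightarrow> nat \<Rightarrow> real"
  where "centroid n K =
    (1 / measure (lebesgue_Rn n) K) *\<^sub>R (\<lambda>i. LINT x:K|lebesgue_Rn n. x i)"

definition unit_ball :: "nat \<Rightarrow> (nat \<Rightarrow> real) set"
  where "unit_ball n = {x \<in> Rn n. euclidean_norm n x \<le> 1}"

definition is_ellipsoid_centered :: "nat \<Rightarrow> (nat \<Rightarrow> real) \<Rightarrow> (nat \<Rightarrow> real) set \<Rightarrow> bool"
  where "is_ellipsoid_centered n c E \<longleftrightarrow>
    c \<in> Rn n \<and> (\<exists>f. linear f \<and> bij_betw f (Rn n) (Rn n) \<and> E = (\<lambda>x. c + f x) ` unit_ball n)"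

definition ellipsoids :: "nat \<Rightarrow> (nat \<Rightarrow> real) set set"
  where "ellipsoids n = {E. \<exists>c. is_ellipsoid_centered n c E}"

definition ellipsoid_center :: "nat \<Rightarrow> (nat \<Rightarrow> real) set \<Rightarrow> nat \<Rightarrow> real"
  where "ellipsoid_center n E = (THE c. is_ellipsoid_centered n c E)"

definition loewner_ellipsoid :: "nat \<Rightarrow> (nat \<Rightarrow> real) set \<Rightarrow> (nat \<Rightarrow> real) set"
  where "loewner_ellipsoid n K =
    (THE E. E \<in> ellipsoids n \<and> K \<subseteq> E \<and>
      (\<forall>E' \<in> ellipsoids n. K \<subseteq> E' \<longrightarrow> measure (lebesgue_Rn n) E \<le> measure (lebesgue_Rn n) E'))"

definition loewner_center :: "nat \<Rightarrow> (nat \<Rightarrow> real) set \<Rightarrow> nat \<Rightarrow> real"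
  where "loewner_center n K = ellipsoid_center n (loewner_ellipsoid n K)"

text \<open>
  The length of the part of \<open>S\<close> on the line through \<open>p \<noteq> q\<close>, measured in the arc-length
  parameter \<open>t\<close> of that line.
\<close>

definition length_on_line ::
    "nat \<Rightarrow> (nat \<Rightarrow> real) \<Rightarrow> (nat \<Rightarrow> real) \<Rightarrow> (nat \<Rightarrow> real) set \<Rightarrow> real"
  where "length_on_line n p q S =
    measure lborel {t. p + (t / euclidean_norm n (q - p)) *\<^sub>R (q - p) \<in> S}"

definition rel_dist ::
    "nat \<Rightarrow> (nat \<Rightarrow> real) set \<Rightarrow> (nat \<Rightarrow> real) \<Rightarrow> (nat \<Rightarrow> real) \<Rightarrow> real"
  where "rel_dist n K p q =
    (if p = q then 0
     else euclidean_norm n (p - q) / length_on_line n p q (affine hull {p, q} \<inter> K))"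

end

(*
  The body is the convex hull W of two parallel (n-1)-dimensional balls, of radius b at height p = -3/5
  and of radius r < b at height q = 5/(3n), and of the points at height q at distance a > r from the
  axis in the coordinate directions. The boundary of the first ball and these extra points lie on the
  unit sphere, and suitable weights on them form a John decomposition of the identity because
  -pq = 1/n; so the unit ball is the Loewner ellipsoid and its center 0 is close to the upper
  end of the axis. As long as 2rb > 1 the extra points add an exponentially small part of the volume,
  so the mass is distributed along the axis as in a truncated cone, and the centroid lies at relative
  height 1/(n(1 - r/b)) above the lower end. Altogether the relative distance is
  1 - (25/9 + 1/(1 - r/b))/n + o(1/n), and the ratio r/b is chosen to give the required constant.

  Minimality of the unit ball: an ellipsoid is the sublevel set of a quadratic form, completing squares
  turns the form into a sum of squares of triangular linear forms, whose diagonal gives the volume by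
  Fubini, and the trace bound given by the John decomposition bounds the product of the diagonal.
*)

theory Submission
  imports Defs "HOL-Real_Asymp.Real_Asymp"
begin

section \<open>Lebesgue measure and triangular maps\<close>

text \<open>For general p the constant would be 1/p^2 + 1/(1 - r/b): since -pq = 1/n, the center 0
  lies a fraction q/(q - p) ~ 1/(n p^2) of the axis below its upper end. The target fixes only one
  of the two parameters p and r/b, subject to r < b and 2rb > 1. The choice p = -3/5 makes b = 4/5
  rational, and then every constant above 25/9 + 32/7 can be reached; of the given constant only the
  bound >= 8 is used. The obstacle is that contact points at height q must lie at a distance near 1
  from the axis, whereas a centroid near the lower end needs sections that shrink upwards. The extra
  points reconcile the two: they reach the sphere in every coordinate direction at negligible cost
  in volume. Volumes are only ever compared with that of the cone, so the volume of the unit ball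
  cancels. Only lower triangular maps need a change of variables, which reduces it to substitutions
  on the line.\<close>

lemma borel_measurable_coordinate [measurable]:
  "(\<lambda>x::nat \<Rightarrow> real. x i) \<in> borel_measurable borel"
  by (intro borel_measurable_continuous_onI continuous_on_product_coordinates)

lemma borel_measurable_restrict_Rn [measurable]:
  fixes n :: nat
  shows "(\<lambda>x i. if i < n then x i else 0) \<in> Pi\<^sub>M {..<n} (\<lambda>_. lborel :: real measure) \<rightarrow>\<^sub>M borel"
proof (rule measurable_coordinatewise_then_product)
  fix i
  show "(\<lambda>x. if i < n then x i else 0) \<in> borel_measurable (Pi\<^sub>M {..<n} (\<lambda>_. lborel :: real measure))"
    using measurable_component_singleton[of i "{..<n}" "\<lambda>_. lborel :: real measure"]
    by (cases "i < n") simp_all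
qed

lemma borel_measurable_fun_upd [measurable]:
  assumes [measurable]: "f \<in> borel_measurable M" "g \<in> borel_measurable M"
  shows "(\<lambda>x. (f x :: nat \<Rightarrow> real)(m := g x)) \<in> borel_measurable M"
proof (rule measurable_coordinatewise_then_product)
  fix i
  have "(\<lambda>x. f x i) \<in> borel_measurable M"
    by (rule measurable_compose[OF assms(1)]) measurable
  then show "(\<lambda>x. ((f x)(m := g x)) i) \<in> borel_measurable M"
    by (cases "i = m") auto
qed

lemma sets_lebesgue_Rn [simp, measurable_cong]: "sets (lebesgue_Rn n) = sets borel"
  by (simp add: lebesgue_Rn_def)

lemma space_lebesgue_Rn [simp]: "space (lebesgue_Rn n) = UNIV"
  by (simp add: lebesgue_Rn_def)

lemma closed_Rn: "closed (Rn n)"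
  using closedin_Euclidean_space by (metis closed_closedin euclidean_product_topology)

lemma Rn_sets [measurable]: "Rn n \<in> sets borel"
  by (rule borel_closed[OF closed_Rn])

lemma AE_lebesgue_Rn: "AE x in lebesgue_Rn n. x \<in> Rn n"
  unfolding lebesgue_Rn_def
  by (subst AE_distr_iff) (auto simp: topspace_Euclidean_space)

interpretation lborel_family: product_sigma_finite "\<lambda>_::nat. lborel :: real measure"
  by (rule product_sigma_finite.intro) (rule lborel.sigma_finite_measure_axioms)

lemma nn_integral_lebesgue_Rn_0:
  assumes [measurable]: "g \<in> borel_measurable borel"
  shows "(\<integral>\<^sup>+x. g x \<partial>lebesgue_Rn 0) = g (\<lambda>_. 0)"
  unfolding lebesgue_Rn_def
  by (subst nn_integral_distr) (auto simp: PiM_empty nn_integral_count_space_finite)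

lemma restrict_Rn_fun_upd:
  "(\<lambda>i. if i < Suc m then (y(m := t)) i else 0) = (\<lambda>i. if i < m then y i else (0::real))(m := t)"
  by (auto simp: fun_eq_iff)

text \<open>The last coordinate is innermost here, as suits triangular maps. The reversed order of
  \<open>nn_integral_lebesgue_Rn_Suc_rev\<close> slices a body by height, the axis of the wedge
  being its last coordinate.\<close>

lemma nn_integral_lebesgue_Rn_Suc:
  assumes [measurable]: "g \<in> borel_measurable borel"
  shows "(\<integral>\<^sup>+x. g x \<partial>lebesgue_Rn (Suc m)) = (\<integral>\<^sup>+y. \<integral>\<^sup>+t. g (y(m := t)) \<partial>lborel \<partial>lebesgue_Rn m)"
proof -
  have "(\<integral>\<^sup>+x. g x \<partial>lebesgue_Rn (Suc m)) =
    (\<integral>\<^sup>+x. g (\<lambda>i. if i < Suc m then x i else 0) \<partial>Pi\<^sub>M (insert m {..<m}) (\<lambda>_. lborel))"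
    unfolding lebesgue_Rn_def lessThan_Suc[symmetric] by (rule nn_integral_distr) auto
  also have "\<dots> = (\<integral>\<^sup>+y. \<integral>\<^sup>+t. g (\<lambda>i. if i < Suc m then (y(m := t)) i else 0) \<partial>lborel
      \<partial>Pi\<^sub>M {..<m} (\<lambda>_. lborel))"
  proof (rule lborel_family.product_nn_integral_insert)
    show "(\<lambda>x. g (\<lambda>i. if i < Suc m then x i else 0)) \<in> borel_measurable (Pi\<^sub>M (insert m {..<m}) (\<lambda>_. lborel))"
      unfolding lessThan_Suc[symmetric] by measurable
  qed auto
  also have "\<dots> = (\<integral>\<^sup>+y. \<integral>\<^sup>+t. g ((\<lambda>i. if i < m then y i else 0)(m := t)) \<partial>lborel
      \<partial>Pi\<^sub>M {..<m} (\<lambda>_. lborel))"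
    by (simp only: restrict_Rn_fun_upd)
  also have "\<dots> = (\<integral>\<^sup>+y. \<integral>\<^sup>+t. g (y(m := t)) \<partial>lborel \<partial>lebesgue_Rn m)"
    unfolding lebesgue_Rn_def by (subst nn_integral_distr) auto
  finally show ?thesis .
qed

lemma emeasure_lebesgue_Rn_box:
  assumes "l \<le> u"
  shows "emeasure (lebesgue_Rn n) {x. \<forall>i<n. x i \<in> {l..u}} = ennreal ((u - l) ^ n)"
proof -
  let ?B = "{x::nat \<Rightarrow> real. \<forall>i<n. x i \<in> {l..u}}"
  have m: "?B \<in> sets borel" by measurable
  have "(\<lambda>x i. if i < n then x i else 0) -` ?B \<inter> space (Pi\<^sub>M {..<n} (\<lambda>_. lborel))
      = Pi\<^sub>E {..<n} (\<lambda>_. {l..u})"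
    by (simp add: space_PiM PiE_iff vimage_def set_eq_iff Ball_def)
  then have "emeasure (lebesgue_Rn n) ?B = emeasure (Pi\<^sub>M {..<n} (\<lambda>_. lborel)) (Pi\<^sub>E {..<n} (\<lambda>_. {l..u}))"
    unfolding lebesgue_Rn_def using m by (simp add: emeasure_distr)
  also have "\<dots> = (\<Prod>i<n. ennreal (u - l))"
    using assms by (subst lborel_family.emeasure_PiM) auto
  finally show ?thesis using assms by (simp add: ennreal_power)
qed

lemma sigma_finite_lebesgue_Rn: "sigma_finite_measure (lebesgue_Rn n)"
proof
  let ?B = "\<lambda>k::nat. {x::nat \<Rightarrow> real. \<forall>i<n. x i \<in> {- real k..real k}}"
  have m: "?B k \<in> sets borel" for k by measurable
  have "emeasure (lebesgue_Rn n) (?B k) < \<infinity>" for k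
    by (simp add: emeasure_lebesgue_Rn_box del: atLeastAtMost_iff)
  moreover have "(\<Union>k. ?B k) = UNIV"
  proof (intro set_eqI iffI UNIV_I)
    fix x :: "nat \<Rightarrow> real"
    obtain k where "(\<Sum>i<n. \<bar>x i\<bar>) \<le> real k" using real_arch_simple by blast
    moreover have "i < n \<Longrightarrow> \<bar>x i\<bar> \<le> (\<Sum>i<n. \<bar>x i\<bar>)" for i by (rule member_le_sum) auto
    ultimately have "\<bar>x i\<bar> \<le> real k" if "i < n" for i using that order_trans by blast
    then have "x \<in> ?B k" by (simp add: abs_le_iff minus_le_iff)
    then show "x \<in> (\<Union>k. ?B k)" by blast
  qed
  ultimately show "\<exists>A. countable A \<and> A \<subseteq> sets (lebesgue_Rn n) \<and> \<Union> A = space (lebesgue_Rn n) \<and>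
      (\<forall>a\<in>A. emeasure (lebesgue_Rn n) a \<noteq> \<infinity>)"
    using m by (intro exI[of _ "range ?B"]) (auto simp: less_top)
qed

lemma nn_integral_lebesgue_Rn_Suc_rev:
  assumes [measurable]: "g \<in> borel_measurable borel"
  shows "(\<integral>\<^sup>+x. g x \<partial>lebesgue_Rn (Suc m)) = (\<integral>\<^sup>+t. \<integral>\<^sup>+y. g (y(m := t)) \<partial>lebesgue_Rn m \<partial>lborel)"
proof -
  interpret L: sigma_finite_measure "lebesgue_Rn m" by (rule sigma_finite_lebesgue_Rn)
  interpret pair_sigma_finite "lebesgue_Rn m" "lborel :: real measure" ..
  show ?thesis
    unfolding nn_integral_lebesgue_Rn_Suc[OF assms] by (rule Fubini'[symmetric]) measurable
qed

definition affine_lower :: "nat \<Rightarrow> (nat \<Rightarrow> nat \<Rightarrow> real) \<Rightarrow> (nat \<Rightarrow> real) \<Rightarrow> (nat \<Rightarrow> real) \<Rightarrow> nat \<Rightarrow> real"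
  where "affine_lower n A c x = (\<lambda>i. if i < n then (\<Sum>j\<le>i. A i j * x j) + c i else 0)"

lemma borel_measurable_affine_lower [measurable]:
  "affine_lower n A c \<in> borel_measurable borel"
proof (rule measurable_coordinatewise_then_product)
  fix i
  show "(\<lambda>x. affine_lower n A c x i) \<in> borel_measurable borel"
    unfolding affine_lower_def by (cases "i < n") auto
qed

lemma affine_lower_Suc:
  "affine_lower (Suc n) A c (y(n := t)) =
    (affine_lower n A c y)(n := ((\<Sum>j<n. A n j * y j) + c n) + A n n * t)"
  by (auto simp: affine_lower_def fun_eq_iff lessThan_Suc_atMost[symmetric] less_Suc_eq intro!: sum.cong)

text \<open>With the first n coordinates fixed, the last coordinate of the image is affine in t with
  slope \<open>A n n\<close>, so one substitution on the line contributes that factor, while the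
  earlier coordinates of the image do not involve t. The induction hypothesis then applies to g with
  the last variable integrated out.\<close>

lemma nn_integral_affine_lower:
  assumes [measurable]: "g \<in> borel_measurable borel" and "\<forall>i<n. A i i \<noteq> 0"
  shows "ennreal (\<Prod>i<n. \<bar>A i i\<bar>) * (\<integral>\<^sup>+x. g (affine_lower n A c x) \<partial>lebesgue_Rn n)
    = (\<integral>\<^sup>+x. g x \<partial>lebesgue_Rn n)"
  using assms
proof (induction n arbitrary: g)
  case 0
  note [measurable] = 0(1)
  show ?case
    by (subst (1 2) nn_integral_lebesgue_Rn_0) (auto simp: affine_lower_def)
next
  case (Suc n)
  note [measurable] = Suc.prems(1)
  interpret sigma_finite_measure "lebesgue_Rn n" by (rule sigma_finite_lebesgue_Rn)
  have nz: "A n n \<noteq> 0" using Suc.prems by simp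
  define h where "h y = (\<integral>\<^sup>+t. g (y(n := t)) \<partial>lborel)" for y
  have [measurable]: "h \<in> borel_measurable borel" unfolding h_def by measurable
  let ?s = "\<lambda>y. (\<Sum>j<n. A n j * y j) + c n"
  let ?I = "\<lambda>y. \<integral>\<^sup>+t. g ((affine_lower n A c y)(n := ?s y + A n n * t)) \<partial>lborel"
  have "h (affine_lower n A c y) = ennreal \<bar>A n n\<bar> * ?I y" for y
    unfolding h_def by (rule nn_integral_real_affine[OF _ nz]) measurable
  moreover have [measurable]: "?I \<in> borel_measurable borel" by measurable
  ultimately have I: "ennreal \<bar>A n n\<bar> * (\<integral>\<^sup>+y. ?I y \<partial>lebesgue_Rn n)
      = (\<integral>\<^sup>+y. h (affine_lower n A c y) \<partial>lebesgue_Rn n)"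
    by (simp add: nn_integral_cmult)
  have "ennreal (\<Prod>i<Suc n. \<bar>A i i\<bar>) * (\<integral>\<^sup>+x. g (affine_lower (Suc n) A c x) \<partial>lebesgue_Rn (Suc n))
    = ennreal (\<Prod>i<n. \<bar>A i i\<bar>) * (ennreal \<bar>A n n\<bar> * (\<integral>\<^sup>+y. ?I y \<partial>lebesgue_Rn n))"
    by (subst nn_integral_lebesgue_Rn_Suc, measurable)
       (simp only: affine_lower_Suc prod.lessThan_Suc, simp add: ennreal_mult prod_nonneg mult.assoc)
  also have "\<dots> = (\<integral>\<^sup>+y. h y \<partial>lebesgue_Rn n)"
    unfolding I by (rule Suc.IH) (use Suc.prems in auto)
  finally show ?case unfolding h_def by (simp add: nn_integral_lebesgue_Rn_Suc)
qed

lemma borel_measurable_L2_set [measurable]: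
  "(\<lambda>x. L2_set x {..<n}) \<in> borel_measurable (borel :: (nat \<Rightarrow> real) measure)"
  unfolding L2_set_def by measurable

lemma unit_ball_sets [measurable]: "unit_ball n \<in> sets borel"
  unfolding unit_ball_def euclidean_norm_def by measurable

text \<open>The measure lives on all sequences while balls and ellipsoids are subsets of
  \<open>Rn n\<close>; the complement is a null set, so the restriction can be added or
  dropped.\<close>

lemma emeasure_lebesgue_Rn_Int_Rn:
  assumes [measurable]: "S \<in> sets borel"
  shows "emeasure (lebesgue_Rn n) {x \<in> Rn n. x \<in> S} = emeasure (lebesgue_Rn n) S"
  using AE_lebesgue_Rn[of n] by (intro emeasure_eq_AE) auto

lemma emeasure_affine_lower_vimage:
  assumes [measurable]: "S \<in> sets borel" and "\<forall>i<n. A i i \<noteq> 0"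
  shows "ennreal (\<Prod>i<n. \<bar>A i i\<bar>) * emeasure (lebesgue_Rn n) {x \<in> Rn n. affine_lower n A c x \<in> S}
    = emeasure (lebesgue_Rn n) S"
proof -
  have "emeasure (lebesgue_Rn n) {x \<in> Rn n. affine_lower n A c x \<in> S}
      = emeasure (lebesgue_Rn n) {x. affine_lower n A c x \<in> S}"
    using emeasure_lebesgue_Rn_Int_Rn[of "{x. affine_lower n A c x \<in> S}" n] by simp
  also have "\<dots> = (\<integral>\<^sup>+x. indicator S (affine_lower n A c x) \<partial>lebesgue_Rn n)"
  proof -
    have "(indicator S (affine_lower n A c x) :: ennreal) = indicator {x. affine_lower n A c x \<in> S} x" for x
      by (simp add: indicator_def)
    then show ?thesis by (simp only:) simp
  qed
  finally show ?thesis
    using nn_integral_affine_lower[of "indicator S" n A c] assms by simp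
qed

lemma abs_le_L2_set: "finite A \<Longrightarrow> i \<in> A \<Longrightarrow> \<bar>x i\<bar> \<le> L2_set x A"
  using member_le_L2_set[of A i "\<lambda>i. \<bar>x i\<bar>"] by (simp add: L2_set_def)

lemma emeasure_unit_ball_finite: "emeasure (lebesgue_Rn n) (unit_ball n) < \<infinity>"
proof -
  have "unit_ball n \<subseteq> {x. \<forall>i<n. x i \<in> {-1..1}}"
  proof (intro subsetI CollectI allI impI)
    fix x i assume "x \<in> unit_ball n" "i < n"
    then have "\<bar>x i\<bar> \<le> 1"
      using abs_le_L2_set[of "{..<n}" i x] by (simp add: unit_ball_def euclidean_norm_def)
    then show "x i \<in> {-1..1}" by (simp add: abs_le_iff)
  qed
  then have "emeasure (lebesgue_Rn n) (unit_ball n) \<le> ennreal ((1 - (-1)) ^ n)"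
    by (subst emeasure_lebesgue_Rn_box[symmetric], simp) (rule emeasure_mono, auto)
  then show ?thesis using le_less_trans by fastforce
qed

lemma emeasure_unit_ball_pos: "emeasure (lebesgue_Rn n) (unit_ball n) > 0"
proof -
  \<comment> \<open>With this half-width the sum of the absolute coordinates is at most n/(n + 1),
    and n = 0 causes no division by zero.\<close>
  let ?d = "1 / (real n + 1)"
  have "L2_set x {..<n} \<le> 1" if "\<forall>i<n. x i \<in> {-?d..?d}" for x
  proof -
    have "L2_set x {..<n} \<le> (\<Sum>i<n. \<bar>x i\<bar>)" by (rule L2_set_le_sum_abs)
    also have "\<dots> \<le> (\<Sum>i<n. ?d)" using that by (intro sum_mono) (auto simp: abs_le_iff)
    also have "\<dots> \<le> 1" by simp
    finally show ?thesis .
  qed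
  then have "{x \<in> Rn n. x \<in> {x. \<forall>i<n. x i \<in> {-?d..?d}}} \<subseteq> unit_ball n"
    by (auto simp: unit_ball_def euclidean_norm_def)
  then have "emeasure (lebesgue_Rn n) {x \<in> Rn n. x \<in> {x. \<forall>i<n. x i \<in> {-?d..?d}}}
      \<le> emeasure (lebesgue_Rn n) (unit_ball n)"
    by (rule emeasure_mono) simp
  also have "emeasure (lebesgue_Rn n) {x \<in> Rn n. x \<in> {x. \<forall>i<n. x i \<in> {-?d..?d}}} = ennreal ((?d - -?d) ^ n)"
    by (subst emeasure_lebesgue_Rn_Int_Rn, measurable) (rule emeasure_lebesgue_Rn_box, simp)
  finally show ?thesis
    by (rule less_le_trans[rotated]) simp
qed

lemma emeasure_unit_ball:
  "emeasure (lebesgue_Rn n) (unit_ball n) = ennreal (measure (lebesgue_Rn n) (unit_ball n))"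
  using emeasure_unit_ball_finite[of n] by (simp add: emeasure_eq_ennreal_measure)

lemma measure_unit_ball_pos: "measure (lebesgue_Rn n) (unit_ball n) > 0"
  using emeasure_unit_ball_pos[of n] by (simp add: emeasure_unit_ball)

lemma emeasure_Rn_ball:
  assumes "\<rho> > 0"
  shows "emeasure (lebesgue_Rn n) {x \<in> Rn n. L2_set (\<lambda>i. x i - c i) {..<n} \<le> \<rho>}
    = ennreal (\<rho> ^ n * measure (lebesgue_Rn n) (unit_ball n))"
proof -
  define A where "A = (\<lambda>i j::nat. if i = j then 1 / \<rho> else 0)"
  define d where "d = (\<lambda>i::nat. - c i / \<rho>)"
  have "affine_lower n A d x i = (if i < n then (x i - c i) / \<rho> else 0)" for x i
    by (simp add: affine_lower_def A_def d_def if_distrib[where f="\<lambda>t. t * _"] diff_divide_distrib cong: if_cong)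
  then have 1: "affine_lower n A d x = (\<lambda>i. if i < n then (x i - c i) / \<rho> else 0)" for x
    by (simp add: fun_eq_iff)
  have "L2_set (\<lambda>i. if i < n then (x i - c i) / \<rho> else 0) {..<n} = L2_set (\<lambda>i. x i - c i) {..<n} / \<rho>" for x
  proof -
    have "L2_set (\<lambda>i. if i < n then (x i - c i) / \<rho> else 0) {..<n} = L2_set (\<lambda>i. (x i - c i) * (1 / \<rho>)) {..<n}"
      by (rule L2_set_cong) auto
    then show ?thesis
      using assms L2_set_left_distrib[of "1 / \<rho>" "\<lambda>i. x i - c i" "{..<n}"] by simp
  qed
  then have "{x \<in> Rn n. L2_set (\<lambda>i. x i - c i) {..<n} \<le> \<rho>} = {x \<in> Rn n. affine_lower n A d x \<in> unit_ball n}"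
    using assms by (auto simp: 1 unit_ball_def euclidean_norm_def topspace_Euclidean_space divide_le_eq)
  moreover have "ennreal ((1 / \<rho>) ^ n) * emeasure (lebesgue_Rn n) {x \<in> Rn n. affine_lower n A d x \<in> unit_ball n}
      = emeasure (lebesgue_Rn n) (unit_ball n)"
    using emeasure_affine_lower_vimage[of "unit_ball n" n A d] assms by (simp add: A_def)
  ultimately have "ennreal (\<rho> ^ n) * (ennreal ((1 / \<rho>) ^ n) * emeasure (lebesgue_Rn n) {x \<in> Rn n. L2_set (\<lambda>i. x i - c i) {..<n} \<le> \<rho>})
      = ennreal (\<rho> ^ n) * ennreal (measure (lebesgue_Rn n) (unit_ball n))"
    by (simp add: emeasure_unit_ball)
  then show ?thesis
    using assms by (simp add: mult.assoc[symmetric] ennreal_mult[symmetric] power_mult_distrib[symmetric])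
qed

section \<open>Quadratic forms as sums of squares of triangular linear forms\<close>

text \<open>What remains in the first n variables is the Schur complement of \<open>G n n\<close>.
  Eliminating the last variable first lets the form with index n involve x 0, ..., x n, as a lower
  triangular matrix requires.\<close>

lemma completing_the_square:
  fixes G :: "nat \<Rightarrow> nat \<Rightarrow> real"
  assumes sym: "\<And>i j. G i j = G j i" and d: "G n n > 0"
  shows "(\<Sum>i<Suc n. \<Sum>j<Suc n. G i j * x i * x j)
    = (\<Sum>i<n. \<Sum>j<n. (G i j - G n i * G n j / G n n) * x i * x j)
      + (\<Sum>j\<le>n. G n j / sqrt (G n n) * x j)\<^sup>2"
proof -
  let ?d = "G n n" let ?s = "\<Sum>j<n. G n j * x j"
  have "(\<Sum>j\<le>n. G n j / sqrt ?d * x j) = (?s + ?d * x n) / sqrt ?d"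
    by (simp add: lessThan_Suc_atMost[symmetric] sum_divide_distrib add_divide_distrib)
  then have 1: "(\<Sum>j\<le>n. G n j / sqrt ?d * x j)\<^sup>2 = (?s + ?d * x n)\<^sup>2 / ?d"
    using d by (simp add: power_divide)
  have "?s\<^sup>2 = (\<Sum>i<n. \<Sum>j<n. G n i * G n j * x i * x j)"
    by (simp add: power2_eq_square sum_product mult_ac)
  then have "(\<Sum>i<n. \<Sum>j<n. G n i * G n j / ?d * x i * x j) = ?s\<^sup>2 / ?d"
    by (simp add: sum_divide_distrib)
  then have 2: "(\<Sum>i<n. \<Sum>j<n. (G i j - G n i * G n j / ?d) * x i * x j)
    = (\<Sum>i<n. \<Sum>j<n. G i j * x i * x j) - ?s\<^sup>2 / ?d"
    by (simp add: left_diff_distrib sum_subtractf)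
  have "(\<Sum>i<n. G i n * x i * x n) = (\<Sum>i<n. G n i * x i * x n)"
    by (simp only: sym[of _ n])
  then have 3: "(\<Sum>i<Suc n. \<Sum>j<Suc n. G i j * x i * x j)
    = (\<Sum>i<n. \<Sum>j<n. G i j * x i * x j) + 2 * ?s * x n + ?d * (x n)\<^sup>2"
    by (simp add: sum.distrib sum_distrib_right sum_distrib_left power2_eq_square mult_ac)
  show ?thesis
    unfolding 1 2 3 using d by (simp add: field_simps power2_eq_square)
qed

lemma cholesky:
  fixes G :: "nat \<Rightarrow> nat \<Rightarrow> real"
  assumes "\<And>i j. G i j = G j i"
    and "\<And>x. (\<exists>i<n. x i \<noteq> 0) \<Longrightarrow> (\<Sum>i<n. \<Sum>j<n. G i j * x i * x j) > 0"
  shows "\<exists>R. (\<forall>i<n. R i i > 0) \<and>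
    (\<forall>x. (\<Sum>i<n. \<Sum>j<n. G i j * x i * x j) = (\<Sum>i<n. (\<Sum>j\<le>i. R i j * x j)\<^sup>2))"
  using assms
proof (induction n arbitrary: G)
  case (Suc n)
  have "(\<Sum>i<Suc n. \<Sum>j<Suc n. G i j * (if i = n then 1 else 0) * (if j = n then 1 else 0)) = G n n"
    by (simp add: if_distrib[where f="\<lambda>t. _ * t"] if_distrib[where f="\<lambda>t. t * _"] cong: if_cong)
  then have d: "G n n > 0"
    using Suc.prems(2)[of "\<lambda>i. if i = n then 1 else 0"] by auto
  define G' where "G' = (\<lambda>i j. G i j - G n i * G n j / G n n)"
  have cs: "(\<Sum>i<Suc n. \<Sum>j<Suc n. G i j * x i * x j)
    = (\<Sum>i<n. \<Sum>j<n. G' i j * x i * x j) + (\<Sum>j\<le>n. G n j / sqrt (G n n) * x j)\<^sup>2" for x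
    unfolding G'_def using completing_the_square[of G n x] Suc.prems(1) d by blast
  have "\<exists>R. (\<forall>i<n. R i i > 0) \<and>
    (\<forall>x. (\<Sum>i<n. \<Sum>j<n. G' i j * x i * x j) = (\<Sum>i<n. (\<Sum>j\<le>i. R i j * x j)\<^sup>2))"
  proof (rule Suc.IH)
    show "G' i j = G' j i" for i j by (simp add: G'_def Suc.prems(1)[of i j])
    fix x :: "nat \<Rightarrow> real" assume ex: "\<exists>i<n. x i \<noteq> 0"
    \<comment> \<open>The last coordinate of y annihilates the squared form, so the positive value
      of G at y is exactly the value of the Schur complement at x.\<close>
    define y where "y = x(n := - (\<Sum>j<n. G n j * x j) / G n n)"
    have "\<exists>i<Suc n. y i \<noteq> 0" using ex by (auto simp: y_def intro: less_SucI)
    then have "(\<Sum>i<Suc n. \<Sum>j<Suc n. G i j * y i * y j) > 0" by (rule Suc.prems(2))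
    moreover have "(\<Sum>j\<le>n. G n j / sqrt (G n n) * y j) = 0"
    proof -
      have "(\<Sum>j\<le>n. G n j / sqrt (G n n) * y j) = (\<Sum>j\<le>n. G n j * y j) / sqrt (G n n)"
        by (simp add: sum_divide_distrib)
      also have "(\<Sum>j\<le>n. G n j * y j) = 0"
        using d by (simp add: lessThan_Suc_atMost[symmetric] y_def)
      finally show ?thesis by simp
    qed
    moreover have "(\<Sum>i<n. \<Sum>j<n. G' i j * y i * y j) = (\<Sum>i<n. \<Sum>j<n. G' i j * x i * x j)"
      by (simp add: y_def)
    ultimately show "(\<Sum>i<n. \<Sum>j<n. G' i j * x i * x j) > 0"
      using cs[of y] by simp
  qed
  then obtain R where R: "\<forall>i<n. R i i > 0"
    "\<And>x. (\<Sum>i<n. \<Sum>j<n. G' i j * x i * x j) = (\<Sum>i<n. (\<Sum>j\<le>i. R i j * x j)\<^sup>2)" by blast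
  show ?case
  proof (intro exI[of _ "\<lambda>i j. if i = n then G n j / sqrt (G n n) else R i j"] conjI allI impI)
    fix i assume "i < Suc n"
    then show "(if i = n then G n i / sqrt (G n n) else R i i) > 0" using R(1) d by auto
  next
    fix x
    show "(\<Sum>i<Suc n. \<Sum>j<Suc n. G i j * x i * x j) =
      (\<Sum>i<Suc n. (\<Sum>j\<le>i. (if i = n then G n j / sqrt (G n n) else R i j) * x j)\<^sup>2)"
      unfolding cs R(2) by simp
  qed
qed auto

section \<open>Ellipsoids of minimal volume\<close>

lemma Rn_zero [simp]: "0 \<in> Rn n"
  and Rn_add: "x \<in> Rn n \<Longrightarrow> y \<in> Rn n \<Longrightarrow> x + y \<in> Rn n"
  and Rn_diff: "x \<in> Rn n \<Longrightarrow> y \<in> Rn n \<Longrightarrow> x - y \<in> Rn n"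
  and Rn_scaleR: "x \<in> Rn n \<Longrightarrow> r *\<^sub>R x \<in> Rn n"
  by (auto simp: topspace_Euclidean_space scaleR_fun_def)

lemma Rn_sum: "(\<And>i. i \<in> I \<Longrightarrow> f i \<in> Rn n) \<Longrightarrow> (\<Sum>i\<in>I. f i) \<in> Rn n"
  by (induction I rule: infinite_finite_induct) (auto intro: Rn_add)

lemma sum_fun_apply: "(\<Sum>i\<in>I. f i :: 'a \<Rightarrow> real) x = (\<Sum>i\<in>I. f i x)"
  by (induction I rule: infinite_finite_induct) auto

text \<open>A point x is in E iff the preimage of x - c has norm at most 1. The squared norm of this
  preimage is a quadratic form whose matrix G is the Gram matrix of the preimages \<open>A i\<close>
  of the unit vectors; it is positive definite, so \<open>cholesky\<close> applies.\<close>

lemma is_ellipsoid_centered_triangular: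
  assumes "is_ellipsoid_centered n c E"
  obtains R where "\<forall>i<n. R i i > 0"
    and "E = {x \<in> Rn n. (\<Sum>i<n. (\<Sum>j\<le>i. R i j * (x j - c j))\<^sup>2) \<le> 1}"
proof -
  obtain f where c: "c \<in> Rn n" and f: "linear f" "bij_betw f (Rn n) (Rn n)"
    and E: "E = (\<lambda>x. c + f x) ` unit_ball n"
    using assms unfolding is_ellipsoid_centered_def by blast
  interpret linear f by (rule f)
  define e where "e = (\<lambda>i k::nat. if k = i then 1 else 0 :: real)"
  define A where "A i = inv_into (Rn n) f (e i)" for i
  have e: "e i \<in> Rn n" if "i < n" for i using that by (auto simp: e_def topspace_Euclidean_space)
  have A: "A i \<in> Rn n" "f (A i) = e i" if "i < n" for i
    unfolding A_def using e[OF that] f(2) inv_into_into[of "e i" f "Rn n"] f_inv_into_f[of "e i" f "Rn n"]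
    by (simp_all only: bij_betw_def)
  \<comment> \<open>The map f is known to be invertible only on \<open>Rn n\<close>, so its inverse
    there is rebuilt from the preimages of the unit vectors.\<close>
  define S where "S z = (\<Sum>i<n. z i *\<^sub>R A i)" for z :: "nat \<Rightarrow> real"
  have S_Rn: "S z \<in> Rn n" for z
    unfolding S_def using A by (auto intro!: Rn_sum Rn_scaleR)
  have fS: "f (S z) = (\<lambda>k. if k < n then z k else 0)" for z
  proof -
    have "f (S z) = (\<Sum>i<n. z i *\<^sub>R e i)"
      unfolding S_def by (simp add: sum scale A)
    also have "\<dots> = (\<lambda>k. if k < n then z k else 0)"
      by (simp add: fun_eq_iff sum_fun_apply scaleR_fun_def e_def if_distrib[where f="\<lambda>t. _ * t"] cong: if_cong)
    finally show ?thesis .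
  qed
  have fS': "f (S z) = z" if "z \<in> Rn n" for z
    using that unfolding fS by (auto simp: topspace_Euclidean_space fun_eq_iff)
  define G where "G i j = (\<Sum>k<n. A i k * A j k)" for i j
  have q: "(\<Sum>k<n. (S z k)\<^sup>2) = (\<Sum>i<n. \<Sum>j<n. G i j * z i * z j)" for z
  proof -
    have "(\<Sum>k<n. (S z k)\<^sup>2) = (\<Sum>k<n. \<Sum>i<n. \<Sum>j<n. A i k * A j k * z i * z j)"
      by (simp add: S_def sum_fun_apply scaleR_fun_def power2_eq_square sum_product mult_ac)
    also have "\<dots> = (\<Sum>i<n. \<Sum>k<n. \<Sum>j<n. A i k * A j k * z i * z j)" by (rule sum.swap)
    also have "\<dots> = (\<Sum>i<n. \<Sum>j<n. \<Sum>k<n. A i k * A j k * z i * z j)"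
      by (intro sum.cong refl sum.swap)
    finally show ?thesis by (simp add: G_def sum_distrib_right)
  qed
  have "(\<Sum>i<n. \<Sum>j<n. G i j * z i * z j) > 0" if "\<exists>i<n. z i \<noteq> 0" for z
  proof -
    have "f (S z) \<noteq> 0" using that unfolding fS by (auto simp: fun_eq_iff)
    then have "S z \<noteq> 0" using zero by metis
    then obtain k where k: "S z k \<noteq> 0" by (auto simp: fun_eq_iff)
    then have "k < n" using S_Rn[of z] by (auto simp: topspace_Euclidean_space not_le[symmetric])
    then show ?thesis
      unfolding q[symmetric] using k by (intro sum_pos2[of _ k]) auto
  qed
  then obtain R where R: "\<forall>i<n. R i i > 0"
    "\<And>x. (\<Sum>i<n. \<Sum>j<n. G i j * x i * x j) = (\<Sum>i<n. (\<Sum>j\<le>i. R i j * x j)\<^sup>2)"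
    using cholesky[of G n] by (auto simp: G_def mult.commute)
  have ball: "y \<in> unit_ball n \<longleftrightarrow> y \<in> Rn n \<and> (\<Sum>k<n. (y k)\<^sup>2) \<le> 1" for y
    by (auto simp: unit_ball_def euclidean_norm_def L2_set_def)
  have "x \<in> E \<longleftrightarrow> x \<in> Rn n \<and> (\<Sum>k<n. (S (x - c) k)\<^sup>2) \<le> 1" for x
  proof
    assume "x \<in> E"
    then obtain y where y: "y \<in> unit_ball n" "x = c + f y" unfolding E by blast
    then have "y \<in> Rn n" by (simp add: ball)
    moreover from this have fy: "f y \<in> Rn n" using f(2) by (auto simp: bij_betw_def)
    moreover have "x - c = f y" using y by simp
    ultimately have "S (x - c) = y"
      using f(2) fS'[of "f y"] S_Rn[of "f y"] by (auto simp: bij_betw_def inj_on_def)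
    then show "x \<in> Rn n \<and> (\<Sum>k<n. (S (x - c) k)\<^sup>2) \<le> 1"
      using y fy c by (auto simp: ball intro: Rn_add)
  next
    assume x: "x \<in> Rn n \<and> (\<Sum>k<n. (S (x - c) k)\<^sup>2) \<le> 1"
    then have "x = c + f (S (x - c))" using fS'[of "x - c"] c by (simp add: Rn_diff)
    then show "x \<in> E" unfolding E using x S_Rn[of "x - c"] by (intro image_eqI) (auto simp: ball)
  qed
  then have "E = {x \<in> Rn n. (\<Sum>i<n. (\<Sum>j\<le>i. R i j * (x j - c j))\<^sup>2) \<le> 1}"
    by (auto simp: q R(2))
  then show ?thesis using that R(1) by blast
qed

text \<open>The ellipsoid is the preimage of the unit ball under an affine map with matrix R, so
  small volume means a large product of the diagonal.\<close>

lemma measure_triangular_ellipsoid: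
  assumes "\<forall>i<n. R i i > (0::real)"
  shows "(\<Prod>i<n. R i i) * measure (lebesgue_Rn n) {x \<in> Rn n. (\<Sum>i<n. (\<Sum>j\<le>i. R i j * (x j - c j))\<^sup>2) \<le> 1}
    = measure (lebesgue_Rn n) (unit_ball n)"
proof -
  let ?E = "{x \<in> Rn n. (\<Sum>i<n. (\<Sum>j\<le>i. R i j * (x j - c j))\<^sup>2) \<le> 1}"
  define d where "d i = - (\<Sum>j\<le>i. R i j * c j)" for i
  have "affine_lower n R d x = (\<lambda>i. if i < n then (\<Sum>j\<le>i. R i j * (x j - c j)) else 0)" for x
    by (auto simp: affine_lower_def d_def fun_eq_iff right_diff_distrib sum_subtractf)
  then have "?E = {x \<in> Rn n. affine_lower n R d x \<in> unit_ball n}"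
    by (auto simp: unit_ball_def euclidean_norm_def L2_set_def topspace_Euclidean_space)
  moreover have "\<forall>i<n. R i i \<noteq> 0" using assms by auto
  moreover have "(\<Prod>i<n. \<bar>R i i\<bar>) = (\<Prod>i<n. R i i)" using assms by (intro prod.cong) auto
  ultimately have "ennreal (\<Prod>i<n. R i i) * emeasure (lebesgue_Rn n) ?E = emeasure (lebesgue_Rn n) (unit_ball n)"
    using emeasure_affine_lower_vimage[of "unit_ball n" n R d] by simp
  then have "enn2real (ennreal (\<Prod>i<n. R i i) * emeasure (lebesgue_Rn n) ?E) = measure (lebesgue_Rn n) (unit_ball n)"
    by (simp add: measure_def)
  moreover have "(\<Prod>i<n. R i i) \<ge> 0" using assms by (intro prod_nonneg) (auto intro: less_imp_le)
  ultimately show ?thesis by (simp add: enn2real_mult measure_def)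
qed

section \<open>John's condition and minimality of the unit ball\<close>

locale john_decomposition =
  fixes n :: nat and I :: "'k set" and w :: "'k \<Rightarrow> real" and u :: "'k \<Rightarrow> nat \<Rightarrow> real"
  assumes finite_I: "finite I" and w_nonneg: "\<And>k. k \<in> I \<Longrightarrow> w k \<ge> 0"
    and sum_w: "(\<Sum>k\<in>I. w k) = real n"
    and sum_wu: "\<And>i. i < n \<Longrightarrow> (\<Sum>k\<in>I. w k * u k i) = 0"
    and sum_wuu: "\<And>i j. i < n \<Longrightarrow> j < n \<Longrightarrow> (\<Sum>k\<in>I. w k * (u k i * u k j)) = (if i = j then 1 else 0)"
    and n_pos: "n \<ge> 1"
begin

text \<open>Averaging the hypothesis with the weights w: the vanishing first moments remove the
  mixed terms, the second moments turn each row of R into its sum of squares, and the total weight n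
  multiplies the constant terms.\<close>

lemma trace_bound:
  assumes "\<And>k. k \<in> I \<Longrightarrow> (\<Sum>i<n. (\<Sum>j\<le>i. R i j * (u k j - c j))\<^sup>2) \<le> 1"
  shows "(\<Sum>i<n. \<Sum>j\<le>i. (R i j)\<^sup>2) + real n * (\<Sum>i<n. (\<Sum>j\<le>i. R i j * c j)\<^sup>2) \<le> real n"
proof -
  define l where "l i x = (\<Sum>j\<le>i. R i j * x j)" for i and x :: "nat \<Rightarrow> real"
  have l1: "(\<Sum>k\<in>I. w k * l i (u k)) = 0" if "i < n" for i
  proof -
    have "(\<Sum>k\<in>I. w k * l i (u k)) = (\<Sum>k\<in>I. \<Sum>j\<le>i. R i j * (w k * u k j))"
      by (simp add: l_def sum_distrib_left mult_ac)
    also have "\<dots> = (\<Sum>j\<le>i. R i j * (\<Sum>k\<in>I. w k * u k j))"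
      by (subst sum.swap) (simp add: sum_distrib_left)
    also have "\<dots> = 0" using that by (intro sum.neutral) (auto simp: sum_wu)
    finally show ?thesis .
  qed
  have l2: "(\<Sum>k\<in>I. w k * (l i (u k))\<^sup>2) = (\<Sum>j\<le>i. (R i j)\<^sup>2)" if "i < n" for i
  proof -
    have "(\<Sum>k\<in>I. w k * (l i (u k))\<^sup>2) = (\<Sum>k\<in>I. \<Sum>j\<le>i. \<Sum>j'\<le>i. R i j * R i j' * (w k * (u k j * u k j')))"
      by (simp add: l_def sum_distrib_left power2_eq_square sum_product mult_ac)
    also have "\<dots> = (\<Sum>j\<le>i. \<Sum>k\<in>I. \<Sum>j'\<le>i. R i j * R i j' * (w k * (u k j * u k j')))" by (rule sum.swap)
    also have "\<dots> = (\<Sum>j\<le>i. \<Sum>j'\<le>i. \<Sum>k\<in>I. R i j * R i j' * (w k * (u k j * u k j')))"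
      by (intro sum.cong refl sum.swap)
    also have "\<dots> = (\<Sum>j\<le>i. \<Sum>j'\<le>i. R i j * R i j' * (if j = j' then 1 else 0))"
      using that by (intro sum.cong refl) (simp add: sum_distrib_left[symmetric] sum_wuu)
    also have "\<dots> = (\<Sum>j\<le>i. (R i j)\<^sup>2)"
      by (simp add: if_distrib[where f="\<lambda>t. _ * t"] power2_eq_square cong: if_cong)
    finally show ?thesis .
  qed
  have "(\<Sum>k\<in>I. w k * (\<Sum>i<n. (l i (u k) - l i c)\<^sup>2)) \<le> (\<Sum>k\<in>I. w k * 1)"
    using assms by (intro sum_mono mult_left_mono w_nonneg) (auto simp: l_def right_diff_distrib sum_subtractf)
  moreover have "(\<Sum>k\<in>I. w k * (\<Sum>i<n. (l i (u k) - l i c)\<^sup>2))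
    = (\<Sum>i<n. (\<Sum>k\<in>I. w k * (l i (u k))\<^sup>2) - 2 * l i c * (\<Sum>k\<in>I. w k * l i (u k)) + (l i c)\<^sup>2 * (\<Sum>k\<in>I. w k))"
  proof -
    have "(\<Sum>k\<in>I. w k * (\<Sum>i<n. (l i (u k) - l i c)\<^sup>2)) = (\<Sum>k\<in>I. \<Sum>i<n. w k * (l i (u k) - l i c)\<^sup>2)"
      by (simp add: sum_distrib_left)
    also have "\<dots> = (\<Sum>i<n. \<Sum>k\<in>I. w k * (l i (u k))\<^sup>2 - 2 * l i c * (w k * l i (u k)) + (l i c)\<^sup>2 * w k)"
      by (subst sum.swap) (simp add: power2_diff algebra_simps)
    finally show ?thesis by (simp add: sum.distrib sum_subtractf sum_distrib_left)
  qed
  ultimately show ?thesis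
    by (simp add: l1 l2 sum_w sum.distrib mult.commute[of _ "real n"] sum_distrib_left[symmetric] sum_distrib_right[symmetric] l_def[symmetric])
qed

text \<open>The inequality of arithmetic and geometric means in logarithmic form: ln s <= s - 1 at
  the squared diagonal entries, combined with \<open>trace_bound\<close>. The equality case is
  included because uniqueness of the ellipsoid and of its center rests on it.\<close>

lemma determinant_bound:
  assumes R: "\<forall>i<n. R i i > 0"
    and "\<And>k. k \<in> I \<Longrightarrow> (\<Sum>i<n. (\<Sum>j\<le>i. R i j * (u k j - c j))\<^sup>2) \<le> 1"
  shows "(\<Prod>i<n. R i i) \<le> 1"
    and "(\<Prod>i<n. R i i) \<ge> 1 \<Longrightarrow> i < n \<Longrightarrow> R i i = 1 \<and> (\<forall>j<i. R i j = 0) \<and> c i = 0"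
proof -
  \<comment> \<open>\<open>P i\<close> collects what row i loses: the entries off the diagonal, the
    shift of the center and the slack of ln s <= s - 1. All are nonnegative, so a product >= 1
    forces each of them to vanish.\<close>
  define P where "P i = (\<Sum>j<i. (R i j)\<^sup>2) + real n * (\<Sum>j\<le>i. R i j * c j)\<^sup>2 + ((R i i)\<^sup>2 - 1 - ln ((R i i)\<^sup>2))" for i
  have ln: "ln ((R i i)\<^sup>2) \<le> (R i i)\<^sup>2 - 1" if "i < n" for i
    using R that by (intro ln_le_minus_one) (auto simp: less_le)
  have P: "P i \<ge> 0" if "i < n" for i
    unfolding P_def using ln[OF that] by (intro add_nonneg_nonneg sum_nonneg mult_nonneg_nonneg) auto
  have pos: "(\<Prod>i<n. R i i) > 0" using R by (intro prod_pos) auto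
  have "2 * ln (\<Prod>i<n. R i i) = ln (\<Prod>i<n. (R i i)\<^sup>2)"
    using pos by (simp add: prod_power_distrib[symmetric] ln_realpow)
  also have "\<dots> = (\<Sum>i<n. ln ((R i i)\<^sup>2))"
    using R by (intro ln_prod) auto
  also have "\<dots> \<le> - (\<Sum>i<n. P i)"
  proof -
    have "(\<Sum>i<n. P i) + (\<Sum>i<n. ln ((R i i)\<^sup>2)) =
      (\<Sum>i<n. \<Sum>j\<le>i. (R i j)\<^sup>2) + real n * (\<Sum>i<n. (\<Sum>j\<le>i. R i j * c j)\<^sup>2) - real n"
      unfolding P_def by (simp add: sum.distrib sum_subtractf sum_distrib_left lessThan_Suc_atMost[symmetric])
    then show ?thesis using trace_bound[OF assms(2)] by simp
  qed
  finally have *: "2 * ln (\<Prod>i<n. R i i) \<le> - (\<Sum>i<n. P i)" .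
  moreover have "(\<Sum>i<n. P i) \<ge> 0" using P by (intro sum_nonneg) auto
  ultimately have "ln (\<Prod>i<n. R i i) \<le> 0" by simp
  then show "(\<Prod>i<n. R i i) \<le> 1" using pos by simp
  assume ge: "(\<Prod>i<n. R i i) \<ge> 1"
  then have "ln (\<Prod>i<n. R i i) \<ge> 0" by simp
  with * have "(\<Sum>i<n. P i) \<le> 0" by simp
  then have P0: "P i = 0" if "i < n" for i
  proof -
    have "(\<Sum>i<n. P i) = 0" using \<open>(\<Sum>i<n. P i) \<le> 0\<close> \<open>(\<Sum>i<n. P i) \<ge> 0\<close> by simp
    then show ?thesis using that P sum_nonneg_eq_0_iff[of "{..<n}" P] by simp
  qed
  have parts: "R i i = 1" "\<forall>j<i. R i j = 0" "(\<Sum>j\<le>i. R i j * c j) = 0" if i: "i < n" for i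
  proof -
    have 1: "(\<Sum>j<i. (R i j)\<^sup>2) \<ge> 0" "real n * (\<Sum>j\<le>i. R i j * c j)\<^sup>2 \<ge> 0"
      by (auto intro: sum_nonneg)
    with P0[OF i] ln[OF i] have 2: "(\<Sum>j<i. (R i j)\<^sup>2) = 0" "real n * (\<Sum>j\<le>i. R i j * c j)\<^sup>2 = 0"
      "ln ((R i i)\<^sup>2) = (R i i)\<^sup>2 - 1" unfolding P_def by linarith+
    show "\<forall>j<i. R i j = 0" using 2(1) by (simp add: sum_nonneg_eq_0_iff)
    show "(\<Sum>j\<le>i. R i j * c j) = 0" using 2(2) n_pos by simp
    have "(R i i)\<^sup>2 = 1" using 2(3) R i by (intro ln_eq_minus_one) (auto simp: less_le)
    then show "R i i = 1" using R i by (auto simp: power2_eq_1_iff)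
  qed
  assume i: "i < n"
  then show "R i i = 1 \<and> (\<forall>j<i. R i j = 0) \<and> c i = 0"
    using parts[OF i] by (simp add: lessThan_Suc_atMost[symmetric])
qed

lemma ellipsoid_measure_ge:
  assumes E: "is_ellipsoid_centered n c E" and "\<And>k. k \<in> I \<Longrightarrow> u k \<in> E"
  shows "measure (lebesgue_Rn n) (unit_ball n) \<le> measure (lebesgue_Rn n) E"
    and "measure (lebesgue_Rn n) E \<le> measure (lebesgue_Rn n) (unit_ball n) \<Longrightarrow> c = 0 \<and> E = unit_ball n"
proof -
  obtain R where R: "\<forall>i<n. R i i > 0"
    and ER: "E = {x \<in> Rn n. (\<Sum>i<n. (\<Sum>j\<le>i. R i j * (x j - c j))\<^sup>2) \<le> 1}"
    using is_ellipsoid_centered_triangular[OF E] .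
  have u: "(\<Sum>i<n. (\<Sum>j\<le>i. R i j * (u k j - c j))\<^sup>2) \<le> 1" if "k \<in> I" for k
    using assms(2)[OF that] unfolding ER by simp
  have m: "(\<Prod>i<n. R i i) * measure (lebesgue_Rn n) E = measure (lebesgue_Rn n) (unit_ball n)"
    unfolding ER by (rule measure_triangular_ellipsoid[of n R c, OF R])
  show "measure (lebesgue_Rn n) (unit_ball n) \<le> measure (lebesgue_Rn n) E"
    unfolding m[symmetric] using determinant_bound(1)[of R c, OF R u] R
    by (intro mult_left_le_one_le prod_nonneg) (auto intro: less_imp_le)
  assume le: "measure (lebesgue_Rn n) E \<le> measure (lebesgue_Rn n) (unit_ball n)"
  have "(\<Prod>i<n. R i i) \<ge> 1"
  proof (rule ccontr)
    assume "\<not> ?thesis"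
    moreover have "measure (lebesgue_Rn n) E > 0"
      using m measure_unit_ball_pos[of n] by (metis less_le measure_nonneg mult_zero_right)
    ultimately have "(\<Prod>i<n. R i i) * measure (lebesgue_Rn n) E < 1 * measure (lebesgue_Rn n) E"
      by (intro mult_strict_right_mono) auto
    then show False using m le by simp
  qed
  then have *: "R i i = 1" "\<forall>j<i. R i j = 0" "c i = 0" if "i < n" for i
    using determinant_bound(2)[of R c, OF R u _ that] by auto
  have "c \<in> Rn n" using E by (simp add: is_ellipsoid_centered_def)
  then have c: "c = 0" using *(3) by (auto simp: fun_eq_iff topspace_Euclidean_space not_less[symmetric])
  have "(\<Sum>j\<le>i. R i j * (x j - c j)) = x i" if "i < n" for i x
    using *[OF that] c by (simp add: lessThan_Suc_atMost[symmetric])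
  then have "E = unit_ball n"
    unfolding ER by (auto simp: unit_ball_def euclidean_norm_def L2_set_def)
  then show "c = 0 \<and> E = unit_ball n" using c by blast
qed

text \<open>\<open>loewner_ellipsoid\<close> and \<open>ellipsoid_center\<close> are definite
  descriptions, so uniqueness is needed twice: for the minimal ellipsoid and for the center of the
  ball. Both follow from the equality case of \<open>ellipsoid_measure_ge\<close>.\<close>

lemma loewner_center_eq_0:
  assumes "K \<subseteq> unit_ball n" and u: "\<And>k. k \<in> I \<Longrightarrow> u k \<in> K"
  shows "loewner_center n K = 0"
proof -
  have "linear (\<lambda>x. x :: nat \<Rightarrow> real)" by (rule linear_id[unfolded id_def])
  then have B: "is_ellipsoid_centered n 0 (unit_ball n)"
    unfolding is_ellipsoid_centered_def by (intro conjI Rn_zero exI[of _ "\<lambda>x. x"]) (auto simp: bij_betw_def)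
  have "loewner_ellipsoid n K = unit_ball n"
    unfolding loewner_ellipsoid_def
  proof (rule the_equality)
    show "unit_ball n \<in> ellipsoids n \<and> K \<subseteq> unit_ball n \<and>
      (\<forall>E'\<in>ellipsoids n. K \<subseteq> E' \<longrightarrow> measure (lebesgue_Rn n) (unit_ball n) \<le> measure (lebesgue_Rn n) E')"
    proof (intro conjI ballI impI)
      show "unit_ball n \<in> ellipsoids n" using B unfolding ellipsoids_def by blast
      fix E' assume "E' \<in> ellipsoids n" "K \<subseteq> E'"
      then obtain c where "is_ellipsoid_centered n c E'" unfolding ellipsoids_def by blast
      then show "measure (lebesgue_Rn n) (unit_ball n) \<le> measure (lebesgue_Rn n) E'"
        using ellipsoid_measure_ge(1)[of c E'] u \<open>K \<subseteq> E'\<close> by blast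
    qed fact
  next
    fix E assume E: "E \<in> ellipsoids n \<and> K \<subseteq> E \<and>
      (\<forall>E'\<in>ellipsoids n. K \<subseteq> E' \<longrightarrow> measure (lebesgue_Rn n) E \<le> measure (lebesgue_Rn n) E')"
    then obtain c where c: "is_ellipsoid_centered n c E" unfolding ellipsoids_def by blast
    have "unit_ball n \<in> ellipsoids n" using B unfolding ellipsoids_def by blast
    then have "measure (lebesgue_Rn n) E \<le> measure (lebesgue_Rn n) (unit_ball n)" using E assms(1) by blast
    then show "E = unit_ball n" using ellipsoid_measure_ge(2)[OF c] u E by blast
  qed
  moreover have "ellipsoid_center n (unit_ball n) = 0"
    unfolding ellipsoid_center_def
  proof (rule the_equality)
    fix c assume "is_ellipsoid_centered n c (unit_ball n)"
    then show "c = 0" using ellipsoid_measure_ge(2)[of c "unit_ball n"] u assms(1) by blast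
  qed (rule B)
  ultimately show ?thesis by (simp add: loewner_center_def)
qed

end

section \<open>The wedge\<close>

text \<open>
  The convex hull of the ball of radius \<open>b\<close> at height \<open>p\<close> and of the ball of radius \<open>r\<close> together
  with the cross-polytope of radius \<open>a\<close> at height \<open>q\<close>, written as an intersection of half-spaces:
  the least admissible \<open>s\<close> is the value at \<open>u\<close> of the support function of the section at \<open>q\<close>.
\<close>

definition wedge_body :: "nat \<Rightarrow> real \<Rightarrow> real \<Rightarrow> real \<Rightarrow> real \<Rightarrow> real \<Rightarrow> (nat \<Rightarrow> real) set"
  where "wedge_body m a b r p q = {x \<in> Rn (Suc m). p \<le> x m \<and> x m \<le> q \<and>
    (\<forall>u s. r * L2_set u {..<m} \<le> s \<longrightarrow> (\<forall>i<m. a * \<bar>u i\<bar> \<le> s) \<longrightarrow>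
      (q - p) * (\<Sum>i<m. u i * x i) \<le> (q - x m) * b * L2_set u {..<m} + (x m - p) * s)}"

text \<open>The truncated cone inside the body: linear interpolation from b at height p to r at
  height q.\<close>

definition radius :: "real \<Rightarrow> real \<Rightarrow> real \<Rightarrow> real \<Rightarrow> real \<Rightarrow> real"
  where "radius b r p q t = ((q - t) * b + (t - p) * r) / (q - p)"

lemma continuous_on_coordinate [continuous_intros]:
  "continuous_on S (\<lambda>x::nat \<Rightarrow> real. x i)"
  by (rule continuous_on_subset[OF continuous_on_product_coordinates]) simp

lemma Euclidean_space_eq_top_of_set: "Euclidean_space n = top_of_set {x. \<forall>i\<ge>n. x i = 0}"
  by (simp add: Euclidean_space_def euclidean_product_topology)

text \<open>Heine-Borel by way of Tychonoff: K is a closed subset of a product of compact intervals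
  whose factors beyond n are {0}.\<close>

lemma compactin_Euclidean_spaceI:
  assumes "closed K" "K \<subseteq> Rn n" and bd: "\<And>x i. x \<in> K \<Longrightarrow> i < n \<Longrightarrow> \<bar>x i\<bar> \<le> M"
  shows "compactin (Euclidean_space n) K"
proof -
  let ?B = "Pi\<^sub>E UNIV (\<lambda>i. if i < n then {- M..M} else {0})"
  have "compact ?B"
    using compactin_PiE[of "\<lambda>_::nat. euclideanreal" UNIV "\<lambda>i. if i < n then {- M..M} else {0}"]
    by (simp add: euclidean_product_topology)
  moreover have "K \<subseteq> ?B"
    using assms(2) bd by (fastforce simp: topspace_Euclidean_space abs_le_iff)
  ultimately have "compact K"
    using assms(1) by (metis compact_Int_closed inf.absorb_iff2)
  then show ?thesis
    using assms(2) unfolding topspace_Euclidean_space by (simp add: Euclidean_space_eq_top_of_set compactin_subtopology)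
qed

lemma L2_set_Suc_squared: "(L2_set x {..<Suc m})\<^sup>2 = (L2_set x {..<m})\<^sup>2 + (x m)\<^sup>2"
  by (simp add: L2_set_def sum_nonneg)

lemma sum_mult_le_L2_set: "(\<Sum>i\<in>I. u i * x i) \<le> L2_set u I * L2_set x I"
proof -
  have "(\<Sum>i\<in>I. u i * x i) \<le> (\<Sum>i\<in>I. \<bar>u i\<bar> * \<bar>x i\<bar>)"
    by (intro sum_mono) (simp add: abs_mult[symmetric])
  also have "\<dots> \<le> L2_set u I * L2_set x I" by (rule L2_set_mult_ineq)
  finally show ?thesis .
qed

lemma sum_mult_self_L2_set: "(\<Sum>i\<in>I. x i * x i) = (L2_set x I)\<^sup>2"
  by (simp add: L2_set_def sum_nonneg power2_eq_square)

locale wedge =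
  fixes m :: nat and a b r p q :: real
  assumes a: "0 < a" and b: "0 < b" and r: "0 < r" and pq: "p < q"
begin

abbreviation W where "W \<equiv> wedge_body m a b r p q"
abbreviation \<rho> where "\<rho> \<equiv> radius b r p q"

lemma radius_pos: "p \<le> t \<Longrightarrow> t \<le> q \<Longrightarrow> \<rho> t > 0"
proof -
  assume t: "p \<le> t" "t \<le> q"
  have "(q - t) * b + (t - p) * r > 0"
  proof (cases "t = q")
    case False
    then have "(q - t) * b > 0" using t b by simp
    then show ?thesis using t r by (simp add: add_pos_nonneg)
  qed (use pq r in simp)
  then show ?thesis using pq by (simp add: radius_def)
qed

lemma W_subset_Rn: "W \<subseteq> Rn (Suc m)"
  by (auto simp: wedge_body_def)

lemma closed_W: "closed W"
proof -
  have "closed {x. p \<le> x m \<and> x m \<le> q \<and>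
    (\<forall>u s. r * L2_set u {..<m} \<le> s \<longrightarrow> (\<forall>i<m. a * \<bar>u i\<bar> \<le> s) \<longrightarrow>
      (q - p) * (\<Sum>i<m. u i * x i) \<le> (q - x m) * b * L2_set u {..<m} + (x m - p) * s)}"
    by (intro closed_Collect_conj closed_Collect_all closed_Collect_imp open_Collect_const
        closed_Collect_le continuous_intros)
  then have "closed (Rn (Suc m) \<inter> {x. p \<le> x m \<and> x m \<le> q \<and>
    (\<forall>u s. r * L2_set u {..<m} \<le> s \<longrightarrow> (\<forall>i<m. a * \<bar>u i\<bar> \<le> s) \<longrightarrow>
      (q - p) * (\<Sum>i<m. u i * x i) \<le> (q - x m) * b * L2_set u {..<m} + (x m - p) * s)})"
    by (rule closed_Int[OF closed_Rn])
  then show ?thesis unfolding wedge_body_def Collect_conj_eq by simp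
qed

lemma W_sets [measurable]: "W \<in> sets borel"
  by (rule borel_closed[OF closed_W])

lemma convex_W: "convex W"
proof (rule convexI)
  fix x y :: "nat \<Rightarrow> real" and \<kappa> \<mu> :: real
  assume x: "x \<in> W" and y: "y \<in> W" and l: "0 \<le> \<kappa>" "0 \<le> \<mu>" "\<kappa> + \<mu> = 1"
  define z where "z = \<kappa> *\<^sub>R x + \<mu> *\<^sub>R y"
  have z: "z i = \<kappa> * x i + \<mu> * y i" for i by (simp add: z_def scaleR_fun_def)
  have \<mu>: "\<mu> = 1 - \<kappa>" using l by simp
  have "z \<in> Rn (Suc m)" using x y unfolding z_def by (auto simp: wedge_body_def intro!: Rn_add Rn_scaleR)
  moreover have "p \<le> z m" "z m \<le> q"
    using x y l convex_bound_le[of "x m" q "y m" \<kappa> \<mu>] convex_bound_le[of "- x m" "- p" "- y m" \<kappa> \<mu>]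
    by (auto simp: wedge_body_def z)
  moreover have "(q - p) * (\<Sum>i<m. u i * z i) \<le> (q - z m) * b * L2_set u {..<m} + (z m - p) * s"
    if us: "r * L2_set u {..<m} \<le> s" "\<forall>i<m. a * \<bar>u i\<bar> \<le> s" for u s
  proof -
    have "(q - p) * (\<Sum>i<m. u i * z i) = \<kappa> * ((q - p) * (\<Sum>i<m. u i * x i)) + \<mu> * ((q - p) * (\<Sum>i<m. u i * y i))"
      by (simp add: z distrib_left sum.distrib sum_distrib_left mult_ac)
    also have "\<dots> \<le> \<kappa> * ((q - x m) * b * L2_set u {..<m} + (x m - p) * s)
        + \<mu> * ((q - y m) * b * L2_set u {..<m} + (y m - p) * s)"
      using x y us l by (intro add_mono mult_left_mono) (auto simp: wedge_body_def)
    also have "\<dots> = (q - z m) * b * L2_set u {..<m} + (z m - p) * s"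
      unfolding z \<mu> by (simp add: algebra_simps)
    finally show ?thesis .
  qed
  ultimately show "\<kappa> *\<^sub>R x + \<mu> *\<^sub>R y \<in> W" unfolding z_def[symmetric] by (simp add: wedge_body_def)
qed

text \<open>Cauchy-Schwarz bounds the left-hand side of the defining inequality by the support
  function of the ball, and every admissible s is at least r times the norm of u.\<close>

lemma mem_W_if_radius:
  assumes "x \<in> Rn (Suc m)" "p \<le> x m" "x m \<le> q" "L2_set x {..<m} \<le> \<rho> (x m)"
  shows "x \<in> W"
proof -
  have "(q - p) * (\<Sum>i<m. u i * x i) \<le> (q - x m) * b * L2_set u {..<m} + (x m - p) * s"
    if us: "r * L2_set u {..<m} \<le> s" for u s
  proof -
    have "(q - p) * (\<Sum>i<m. u i * x i) \<le> (q - p) * (L2_set u {..<m} * L2_set x {..<m})"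
      using pq by (intro mult_left_mono sum_mult_le_L2_set) auto
    also have "\<dots> \<le> (q - p) * (L2_set u {..<m} * \<rho> (x m))"
      using assms(4) pq by (intro mult_left_mono) auto
    also have "\<dots> = (q - x m) * b * L2_set u {..<m} + (x m - p) * (r * L2_set u {..<m})"
      using pq by (simp add: radius_def field_simps)
    also have "\<dots> \<le> (q - x m) * b * L2_set u {..<m} + (x m - p) * s"
      using us assms by (intro add_left_mono mult_left_mono) auto
    finally show ?thesis .
  qed
  then show ?thesis using assms by (auto simp: wedge_body_def)
qed

text \<open>Testing the defining inequality of the body against \<open>u = x\<close> is all that the upper bounds need.\<close>

lemma W_self_bound:
  assumes x: "x \<in> W" and s: "r * L2_set x {..<m} \<le> c * L2_set x {..<m}"
    "\<forall>i<m. a * \<bar>x i\<bar> \<le> c * L2_set x {..<m}" and c: "c > 0"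
  shows "L2_set x {..<m} \<le> ((q - x m) * b + (x m - p) * c) / (q - p)"
proof (cases "L2_set x {..<m} = 0")
  case True
  then show ?thesis using x b c pq by (auto simp: wedge_body_def)
next
  case False
  then have pos: "L2_set x {..<m} > 0" by (simp add: less_le)
  have "(q - p) * (L2_set x {..<m})\<^sup>2 \<le> (q - x m) * b * L2_set x {..<m} + (x m - p) * (c * L2_set x {..<m})"
    using x s by (auto simp: wedge_body_def sum_mult_self_L2_set[symmetric])
  then have "((q - p) * L2_set x {..<m}) * L2_set x {..<m} \<le> ((q - x m) * b + (x m - p) * c) * L2_set x {..<m}"
    by (simp add: algebra_simps power2_eq_square)
  then have "(q - p) * L2_set x {..<m} \<le> (q - x m) * b + (x m - p) * c"
    using pos by simp
  then show ?thesis using pq by (simp add: le_divide_eq mult.commute)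
qed

text \<open>With c = max r a both side conditions of \<open>W_self_bound\<close> always
  hold.\<close>

lemma W_bound: "x \<in> W \<Longrightarrow> L2_set x {..<m} \<le> ((q - x m) * b + (x m - p) * max r a) / (q - p)"
  using r a abs_le_L2_set[of "{..<m}" _ x]
  by (intro W_self_bound) (auto intro!: mult_right_mono mult_mono)

text \<open>With c = r the bound of \<open>W_self_bound\<close> is the radius of the cone, and its
  only side condition that can fail is the one on single coordinates. So a point outside the cone
  has a dominant coordinate.\<close>

lemma W_dichotomy: "x \<in> W \<Longrightarrow> L2_set x {..<m} \<le> \<rho> (x m) \<or> (\<exists>i<m. r * L2_set x {..<m} < a * \<bar>x i\<bar>)"
  unfolding radius_def using W_self_bound[of x r] r by (meson not_less order_refl)

lemma W_convex_body: "W \<in> convex_bodies (Suc m)"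
proof -
  have "compactin (Euclidean_space (Suc m)) W"
  proof (rule compactin_Euclidean_spaceI[OF closed_W W_subset_Rn])
    fix x i assume x: "x \<in> W" and i: "i < Suc m"
    show "\<bar>x i\<bar> \<le> b + max r a + \<bar>p\<bar> + \<bar>q\<bar>"
    proof (cases "i = m")
      case True
      then show ?thesis using x r b by (auto simp: wedge_body_def)
    next
      case False
      then have "\<bar>x i\<bar> \<le> L2_set x {..<m}" using i by (intro abs_le_L2_set) auto
      also have "\<dots> \<le> ((q - x m) * b + (x m - p) * max r a) / (q - p)" by (rule W_bound[OF x])
      also have "\<dots> \<le> b + max r a"
      proof -
        have "(q - x m) * b \<le> (q - p) * b" "(x m - p) * max r a \<le> (q - p) * max r a"
          using x a b r by (auto simp: wedge_body_def intro!: mult_right_mono)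
        then show ?thesis using pq by (simp add: divide_le_eq algebra_simps)
      qed
      finally show ?thesis by simp
    qed
  qed
  moreover have "Euclidean_space (Suc m) interior_of W \<noteq> {}"
  proof -
    define U where "U = {x \<in> Rn (Suc m). p < x m \<and> x m < q \<and> L2_set x {..<m} < min b r}"
    have "open {x::nat \<Rightarrow> real. p < x m \<and> x m < q \<and> L2_set x {..<m} < min b r}"
      unfolding L2_set_def by (intro open_Collect_conj open_Collect_less continuous_intros)
    then have "openin (Euclidean_space (Suc m)) ({x. \<forall>i\<ge>Suc m. x i = 0} \<inter> {x. p < x m \<and> x m < q \<and> L2_set x {..<m} < min b r})"
      unfolding Euclidean_space_eq_top_of_set by (rule openin_open_Int)
    then have "openin (Euclidean_space (Suc m)) U"
      by (simp add: U_def topspace_Euclidean_space Collect_conj_eq)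
    moreover have "U \<subseteq> W"
    proof
      fix x assume x: "x \<in> U"
      have "min b r \<le> \<rho> (x m)"
      proof -
        have "(q - x m) * min b r + (x m - p) * min b r \<le> (q - x m) * b + (x m - p) * r"
          using x by (intro add_mono mult_left_mono) (auto simp: U_def)
        then show ?thesis using pq by (simp add: radius_def le_divide_eq algebra_simps)
      qed
      then show "x \<in> W" using x by (intro mem_W_if_radius) (auto simp: U_def)
    qed
    moreover have "(\<lambda>i. if i = m then (p + q) / 2 else 0) \<in> U"
      using b r pq by (auto simp: U_def L2_set_def topspace_Euclidean_space)
    ultimately show ?thesis using interior_of_maximal by blast
  qed
  ultimately show ?thesis using convex_W by (simp add: convex_bodies_def)
qed

lemma contact_a: 
  assumes "i < m" "\<bar>\<sigma>\<bar> = 1"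
  shows "(\<lambda>k. if k = i then \<sigma> * a else if k = m then q else 0) \<in> W"
proof -
  have "\<sigma> * a * u i \<le> s" if "\<forall>i<m. a * \<bar>u i\<bar> \<le> s" for s and u :: "nat \<Rightarrow> real"
  proof -
    have "\<sigma> * a * u i \<le> \<bar>\<sigma> * a * u i\<bar>" by simp
    also have "\<dots> = a * \<bar>u i\<bar>" using assms a by (simp add: abs_mult)
    finally show ?thesis using that assms by force
  qed
  moreover have "(\<Sum>k<m. u k * (if k = i then \<sigma> * a else if k = m then q else 0)) = \<sigma> * a * u i" for u
    using assms by (subst sum.remove[of _ i]) (auto intro!: sum.neutral)
  ultimately show ?thesis
    using assms pq by (auto simp: wedge_body_def topspace_Euclidean_space mult.assoc intro!: mult_left_mono)
qed

lemma contact_b: 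
  assumes "i < m" "\<bar>\<sigma>\<bar> = 1"
  shows "(\<lambda>k. if k = i then \<sigma> * b else if k = m then p else 0) \<in> W"
proof -
  have "\<sigma> * b * u i \<le> b * L2_set u {..<m}" for u :: "nat \<Rightarrow> real"
  proof -
    have "\<sigma> * b * u i \<le> \<bar>\<sigma> * b * u i\<bar>" by simp
    also have "\<dots> = b * \<bar>u i\<bar>" using assms b by (simp add: abs_mult)
    finally show ?thesis using abs_le_L2_set[of "{..<m}" i u] assms b
      by (smt (verit) finite_lessThan lessThan_iff mult_left_mono)
  qed
  moreover have "(\<Sum>k<m. u k * (if k = i then \<sigma> * b else if k = m then p else 0)) = \<sigma> * b * u i" for u
    using assms by (subst sum.remove[of _ i]) (auto intro!: sum.neutral)
  ultimately show ?thesis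
    using assms pq by (auto simp: wedge_body_def topspace_Euclidean_space mult.assoc intro!: mult_left_mono)
qed

end

section \<open>The wedge inscribed in the unit ball\<close>

locale inscribed_wedge = wedge +
  assumes r_le_a: "r \<le> a" and pb: "p\<^sup>2 + b\<^sup>2 = 1" and qa: "q\<^sup>2 + a\<^sup>2 = 1"
    and p_neg: "p < 0" and q_pos: "0 < q" and pq_prod: "- p * q * real (Suc m) = 1" and m_pos: "0 < m"
begin

text \<open>In the half-plane of distance to the axis and height, \<open>W_bound\<close> keeps x
  within the chord from (b, p) to (a, q). Both ends lie on the unit circle, and the identity with
  the factor \<mu> (1 - \<mu>) is the convexity of the squared norm along this chord.\<close>

lemma W_subset_unit_ball: "W \<subseteq> unit_ball (Suc m)"
proof
  fix x assume x: "x \<in> W"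
  define \<mu> where "\<mu> = (x m - p) / (q - p)"
  have \<mu>: "0 \<le> \<mu>" "\<mu> \<le> 1" using x pq by (auto simp: \<mu>_def wedge_body_def)
  have \<mu>1: "1 - \<mu> = (q - x m) / (q - p)" using pq by (simp add: \<mu>_def field_simps)
  have "\<mu> * (q - p) = x m - p" using pq by (simp add: \<mu>_def)
  then have xm: "x m = (1 - \<mu>) * p + \<mu> * q" by (simp add: algebra_simps)
  have "L2_set x {..<m} \<le> (1 - \<mu>) * b + \<mu> * a"
    using W_bound[OF x] r_le_a unfolding \<mu>1 by (simp add: \<mu>_def add_divide_distrib max_def split: if_splits)
  then have "(L2_set x {..<m})\<^sup>2 \<le> ((1 - \<mu>) * b + \<mu> * a)\<^sup>2" by (intro power_mono) auto
  moreover have "((1 - \<mu>) * b + \<mu> * a)\<^sup>2 + ((1 - \<mu>) * p + \<mu> * q)\<^sup>2 \<le> 1"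
  proof -
    have "1 - (((1 - \<mu>) * b + \<mu> * a)\<^sup>2 + ((1 - \<mu>) * p + \<mu> * q)\<^sup>2)
      = (1 - \<mu>) * (p\<^sup>2 + b\<^sup>2) + \<mu> * (q\<^sup>2 + a\<^sup>2) - (((1 - \<mu>) * b + \<mu> * a)\<^sup>2 + ((1 - \<mu>) * p + \<mu> * q)\<^sup>2)"
      by (simp add: pb qa)
    also have "\<dots> = \<mu> * (1 - \<mu>) * ((b - a)\<^sup>2 + (p - q)\<^sup>2)"
      by (simp add: power2_eq_square algebra_simps)
    also have "\<dots> \<ge> 0" using \<mu> by simp
    finally show ?thesis by simp
  qed
  ultimately have "(L2_set x {..<Suc m})\<^sup>2 \<le> 1" by (simp add: L2_set_Suc_squared xm)
  then have "L2_set x {..<Suc m} \<le> 1" using power2_le_imp_le[of "L2_set x {..<Suc m}" 1] by simp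
  then show "x \<in> unit_ball (Suc m)"
    using x by (simp add: unit_ball_def euclidean_norm_def wedge_body_def)
qed

lemma loewner_center_W: "loewner_center (Suc m) W = 0"
proof -
  \<comment> \<open>Each of the 2m upper contact points gets weight c, each of the 2m lower ones
    weight d. The equations c + d = N and c q + d p = 0 give total weight m + 1 and centering. The
    second moment along the axis is then -pqN for one upper and one lower point, which is 1/(2m) by
    \<open>pq_prod\<close>; the horizontal one follows because all the points are unit
    vectors.\<close>
  define N where "N = real (Suc m) / (2 * real m)"
  define c d where "c = - p * N / (q - p)" and "d = q * N / (q - p)"
  define w where "w = (\<lambda>(i::nat, \<sigma>::real, top::bool). if top then c else d)"
  define u where "u = (\<lambda>(i::nat, \<sigma>::real, top::bool) k. if k = i then \<sigma> * (if top then a else b)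
    else if k = m then (if top then q else p) else 0)"
  define I where "I = {..<m} \<times> {1, -1::real} \<times> (UNIV :: bool set)"
  have sum_I: "(\<Sum>k\<in>I. F k) = (\<Sum>i<m. F (i, 1, False) + F (i, 1, True) + (F (i, -1, False) + F (i, -1, True)))" for F :: "_ \<Rightarrow> real"
  proof -
    have "(\<Sum>k\<in>I. F k) = (\<Sum>i<m. \<Sum>\<sigma>\<in>{1,-1}. \<Sum>top\<in>UNIV. F (i, \<sigma>, top))"
      unfolding I_def sum.cartesian_product by (rule sum.cong) auto
    then show ?thesis by (simp add: UNIV_bool)
  qed
  have N: "2 * real m * N = real (Suc m)" using m_pos by (simp add: N_def)
  have "c + d = (q - p) * N / (q - p)"
    by (simp add: c_def d_def diff_divide_distrib left_diff_distrib)
  then have cd: "c + d = N" using pq by simp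
  have first: "c * q + d * p = 0" by (simp add: c_def d_def)
  have "c * q\<^sup>2 + d * p\<^sup>2 = (c * q + d * p) * (p + q) - p * q * (c + d)"
    by (simp add: power2_eq_square algebra_simps)
  also have "\<dots> = - p * q * N" by (simp add: first cd)
  also have "\<dots> = (- p * q * real (Suc m)) / (2 * real m)" by (simp add: N_def)
  finally have second: "c * q\<^sup>2 + d * p\<^sup>2 = 1 / (2 * real m)" unfolding pq_prod .
  have "a\<^sup>2 = 1 - q\<^sup>2" "b\<^sup>2 = 1 - p\<^sup>2" using pb qa by linarith+
  then have "c * a\<^sup>2 + d * b\<^sup>2 = (c + d) - (c * q\<^sup>2 + d * p\<^sup>2)"
    by (simp only:) (simp add: algebra_simps)
  also have "\<dots> = 1 / 2" unfolding cd second N_def using m_pos by (simp add: field_simps)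
  finally have radial: "c * a\<^sup>2 + d * b\<^sup>2 = 1 / 2" .
  have cd_nonneg: "c \<ge> 0" "d \<ge> 0" unfolding c_def d_def N_def
    using p_neg q_pos pq by (intro conjI divide_nonneg_nonneg mult_nonneg_nonneg; simp)+
  interpret john_decomposition "Suc m" I w u
  proof
    show "finite I" by (simp add: I_def)
    show "w k \<ge> 0" for k using cd_nonneg by (auto simp: w_def split: prod.split)
    have "(\<Sum>k\<in>I. w k) = (\<Sum>i<m. 2 * (c + d))"
      unfolding sum_I w_def by (rule sum.cong) auto
    then show "(\<Sum>k\<in>I. w k) = real (Suc m)" using N by (simp add: cd mult_ac)
    show "(\<Sum>k\<in>I. w k * u k j) = 0" if "j < Suc m" for j
    proof (cases "j = m")
      case True
      have "(\<Sum>k\<in>I. w k * u k m) = (\<Sum>i<m. 2 * (c * q + d * p))"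
        unfolding sum_I w_def u_def by (rule sum.cong) auto
      then show ?thesis using True by (simp add: first)
    qed (auto simp: sum_I w_def u_def intro!: sum.neutral)
    show "(\<Sum>k\<in>I. w k * (u k i * u k j)) = (if i = j then 1 else 0)" if ij: "i < Suc m" "j < Suc m" for i j
    proof -
      consider "i = m" "j = m" | "i < m" "j = i" | "i \<noteq> j" using ij by linarith
      then show ?thesis
      proof cases
        case 1
        have "(\<Sum>k\<in>I. w k * (u k m * u k m)) = (\<Sum>k<m. 2 * (c * q\<^sup>2 + d * p\<^sup>2))"
          unfolding sum_I w_def u_def by (rule sum.cong) (auto simp: power2_eq_square)
        then show ?thesis using 1 m_pos by (simp add: second)
      next
        case 2
        have "(\<Sum>k\<in>I. w k * (u k i * u k i)) = (\<Sum>k<m. if i = k then 2 * (c * a\<^sup>2 + d * b\<^sup>2) else 0)"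
          unfolding sum_I w_def u_def using 2 by (intro sum.cong) (auto simp: power2_eq_square)
        then show ?thesis using 2 by (simp add: radial)
      next
        case 3
        then have "(\<Sum>k\<in>I. w k * (u k i * u k j)) = 0"
          unfolding sum_I w_def u_def by (intro sum.neutral) auto
        then show ?thesis using 3 by simp
      qed
    qed
  qed simp
  show ?thesis
  proof (rule loewner_center_eq_0[OF W_subset_unit_ball])
    fix k assume "k \<in> I"
    then obtain i \<sigma> top where k: "k = (i, \<sigma>, top)" "i < m" "\<bar>\<sigma>\<bar> = 1" by (auto simp: I_def)
    then show "u k \<in> W" using contact_a[of i \<sigma>] contact_b[of i \<sigma>] by (cases top) (auto simp: u_def)
  qed
qed

end

section \<open>Volume and first moment of the wedge\<close>

definition reflect :: "nat \<Rightarrow> (nat \<Rightarrow> real) \<Rightarrow> nat \<Rightarrow> real"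
  where "reflect i x = x(i := - x i)"

lemma reflect_measurable [measurable]: "reflect i \<in> borel_measurable borel"
  unfolding reflect_def by measurable

lemma reflect_Rn_iff: "i < n \<Longrightarrow> reflect i x \<in> Rn n \<longleftrightarrow> x \<in> Rn n"
  by (auto simp: reflect_def topspace_Euclidean_space)

lemma distr_reflect_lebesgue_Rn:
  assumes "i < n"
  shows "distr (lebesgue_Rn n) borel (reflect i) = lebesgue_Rn n"
proof (rule measure_eqI)
  fix S assume "S \<in> sets (distr (lebesgue_Rn n) borel (reflect i))"
  then have S [measurable]: "S \<in> sets borel" by simp
  define A where "A = (\<lambda>j k::nat. if j = k then (if j = i then -1 else 1) else 0 :: real)"
  have "affine_lower n A (\<lambda>_. 0) x j = reflect i x j" if "x \<in> Rn n" for x j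
    using that assms
    by (auto simp: affine_lower_def A_def reflect_def topspace_Euclidean_space if_distrib[where f="\<lambda>t. t * _"] cong: if_cong)
  then have eq: "affine_lower n A (\<lambda>_. 0) x = reflect i x" if "x \<in> Rn n" for x using that by blast
  have "emeasure (distr (lebesgue_Rn n) borel (reflect i)) S = emeasure (lebesgue_Rn n) {x. reflect i x \<in> S}"
    by (simp add: emeasure_distr vimage_def)
  also have "\<dots> = emeasure (lebesgue_Rn n) {x \<in> Rn n. reflect i x \<in> S}"
    using emeasure_lebesgue_Rn_Int_Rn[of "{x. reflect i x \<in> S}" n] by simp
  also have "{x \<in> Rn n. reflect i x \<in> S} = {x \<in> Rn n. affine_lower n A (\<lambda>_. 0) x \<in> S}"
    using eq by auto
  also have "emeasure (lebesgue_Rn n) \<dots> = emeasure (lebesgue_Rn n) S"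
  proof -
    have "(\<Prod>j<n. \<bar>A j j\<bar>) = 1" by (intro prod.neutral) (auto simp: A_def)
    moreover have "\<forall>j<n. A j j \<noteq> 0" by (auto simp: A_def)
    ultimately show ?thesis using emeasure_affine_lower_vimage[OF S, of n A "\<lambda>_. 0"] by simp
  qed
  finally show "emeasure (distr (lebesgue_Rn n) borel (reflect i)) S = emeasure (lebesgue_Rn n) S" .
qed simp

text \<open>The integral equals its own negative. This holds whether or not the integrand is
  integrable, since the integral is 0 by default otherwise.\<close>

lemma integral_coordinate_reflection_symmetric:
  assumes [measurable]: "K \<in> sets borel" and i: "i < n" and sym: "\<And>x. reflect i x \<in> K \<longleftrightarrow> x \<in> K"
  shows "(LINT x:K|lebesgue_Rn n. x i) = 0"
proof -
  let ?f = "\<lambda>x::nat \<Rightarrow> real. indicator K x * x i"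
  have "integral\<^sup>L (lebesgue_Rn n) ?f = integral\<^sup>L (distr (lebesgue_Rn n) borel (reflect i)) ?f"
    by (simp add: distr_reflect_lebesgue_Rn[OF i])
  also have "\<dots> = integral\<^sup>L (lebesgue_Rn n) (\<lambda>x. ?f (reflect i x))"
    by (rule integral_distr) auto
  also have "(\<lambda>x. ?f (reflect i x)) = (\<lambda>x. - ?f x)"
    using sym by (auto simp: fun_eq_iff indicator_def reflect_def)
  finally show ?thesis by (simp add: set_lebesgue_integral_def)
qed

context wedge
begin

text \<open>The reflection can be moved from x to u in the sum, and the constraints on u and s are
  invariant under it.\<close>

lemma reflect_W: "i < m \<Longrightarrow> reflect i x \<in> W \<longleftrightarrow> x \<in> W"
proof -
  assume i: "i < m"
  have rr: "reflect i (reflect i x) = x" for x by (auto simp: reflect_def)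
  have L2: "L2_set (reflect i u) {..<m} = L2_set u {..<m}" for u
    unfolding L2_set_def by (intro arg_cong[where f=sqrt] sum.cong) (auto simp: reflect_def)
  have "reflect i x \<in> W" if x: "x \<in> W" for x
  proof -
    have "(q - p) * (\<Sum>k<m. u k * reflect i x k) \<le> (q - x m) * b * L2_set u {..<m} + (x m - p) * s"
      if us: "r * L2_set u {..<m} \<le> s" "\<forall>i<m. a * \<bar>u i\<bar> \<le> s" for u s
    proof -
      have "(\<Sum>k<m. u k * reflect i x k) = (\<Sum>k<m. reflect i u k * x k)"
        by (intro sum.cong) (auto simp: reflect_def)
      moreover have "\<forall>k<m. a * \<bar>reflect i u k\<bar> \<le> s" using us(2) by (auto simp: reflect_def)
      moreover have "(q - p) * (\<Sum>k<m. reflect i u k * x k) \<le> (q - x m) * b * L2_set (reflect i u) {..<m} + (x m - p) * s"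
        if "\<forall>k<m. a * \<bar>reflect i u k\<bar> \<le> s"
        using x us(1) that unfolding L2[symmetric, of u] wedge_body_def by blast
      ultimately show ?thesis by (simp only: L2)
    qed
    moreover have "reflect i x m = x m" using i by (simp add: reflect_def)
    moreover have "reflect i x \<in> Rn (Suc m)" using x i by (simp add: reflect_Rn_iff wedge_body_def)
    ultimately show ?thesis using x by (simp add: wedge_body_def)
  qed
  from this[of x] this[of "reflect i x"] show ?thesis by (auto simp: rr)
qed

text \<open>A stack of balls around a common center, general enough for the cone
  (\<open>core\<close>) and for the cylinders in \<open>caps\<close>.\<close>

definition slab :: "(nat \<Rightarrow> real) \<Rightarrow> (real \<Rightarrow> real) \<Rightarrow> (nat \<Rightarrow> real) set"
  where "slab c \<phi> = {x \<in> Rn (Suc m). p \<le> x m \<and> x m \<le> q \<and> L2_set (\<lambda>k. x k - c k) {..<m} \<le> \<phi> (x m)}"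

lemma slab_sets [measurable]:
  assumes [measurable]: "\<phi> \<in> borel_measurable borel"
  shows "slab c \<phi> \<in> sets borel"
proof -
  define h where "h x = \<phi> (x m)" for x :: "nat \<Rightarrow> real"
  have [measurable]: "h \<in> borel_measurable borel"
    unfolding h_def by (rule measurable_compose[OF borel_measurable_coordinate assms])
  have "{x \<in> space borel. L2_set (\<lambda>k. x k - c k) {..<m} \<le> h x} \<in> sets borel"
    by (rule borel_measurable_le) (unfold L2_set_def, measurable)
  then have "{x. p \<le> x m} \<inter> {x. x m \<le> q} \<inter> {x. L2_set (\<lambda>k. x k - c k) {..<m} \<le> h x} \<inter> Rn (Suc m) \<in> sets borel"
    by (intro sets.Int) (simp_all, measurable)
  moreover have "slab c \<phi> = {x. p \<le> x m} \<inter> {x. x m \<le> q} \<inter> {x. L2_set (\<lambda>k. x k - c k) {..<m} \<le> h x} \<inter> Rn (Suc m)"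
    by (auto simp: slab_def h_def)
  ultimately show ?thesis by simp
qed

abbreviation \<omega> where "\<omega> \<equiv> measure (lebesgue_Rn m) (unit_ball m)"

text \<open>Slicing by height: each section is a ball, and the weight depends on the height only.
  The weight 1 gives volumes, the height above p gives first moments.\<close>

lemma nn_integral_slab:
  assumes [measurable]: "\<phi> \<in> borel_measurable borel" "g \<in> borel_measurable borel"
    and pos: "\<And>t. p \<le> t \<Longrightarrow> t \<le> q \<Longrightarrow> \<phi> t > 0"
  shows "(\<integral>\<^sup>+x. indicator (slab c \<phi>) x * g (x m) \<partial>lebesgue_Rn (Suc m))
    = (\<integral>\<^sup>+t. g t * ennreal (\<phi> t ^ m * \<omega>) * indicator {p..q} t \<partial>lborel)"
proof -
  have "(\<integral>\<^sup>+y. indicator (slab c \<phi>) (y(m := t)) * g ((y(m := t)) m) \<partial>lebesgue_Rn m)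
      = g t * ennreal (\<phi> t ^ m * \<omega>) * indicator {p..q} t" for t
  proof -
    define B where "B = {y \<in> Rn m. L2_set (\<lambda>k. y k - c k) {..<m} \<le> \<phi> t}"
    have [measurable]: "B \<in> sets borel" unfolding B_def L2_set_def by measurable
    have L: "L2_set (\<lambda>k. (y(m := t)) k - c k) {..<m} = L2_set (\<lambda>k. y k - c k) {..<m}" for y
      by (intro L2_set_cong) auto
    have "indicator (slab c \<phi>) (y(m := t)) * g ((y(m := t)) m) = g t * indicator {p..q} t * indicator B y"
      if y: "y \<in> Rn m" for y
    proof -
      have "y(m := t) \<in> Rn (Suc m)" using y by (auto simp: topspace_Euclidean_space)
      then have "y(m := t) \<in> slab c \<phi> \<longleftrightarrow> t \<in> {p..q} \<and> y \<in> B"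
        unfolding slab_def B_def mem_Collect_eq L using y by simp
      then show ?thesis by (simp add: indicator_def)
    qed
    then have "(\<integral>\<^sup>+y. indicator (slab c \<phi>) (y(m := t)) * g ((y(m := t)) m) \<partial>lebesgue_Rn m)
      = (\<integral>\<^sup>+y. (g t * indicator {p..q} t) * indicator B y \<partial>lebesgue_Rn m)"
      using AE_lebesgue_Rn[of m] by (intro nn_integral_cong_AE) (auto simp del: fun_upd_apply)
    also have "\<dots> = g t * indicator {p..q} t * emeasure (lebesgue_Rn m) B"
      by (simp add: nn_integral_cmult)
    also have "\<dots> = g t * ennreal (\<phi> t ^ m * \<omega>) * indicator {p..q} t"
      unfolding B_def using pos[of t] by (cases "t \<in> {p..q}") (auto simp: emeasure_Rn_ball)
    finally show ?thesis .
  qed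
  moreover have "(\<lambda>x. indicator (slab c \<phi>) x * g (x m)) \<in> borel_measurable borel"
    using slab_sets[OF assms(1)]
    by (intro borel_measurable_times_ennreal borel_measurable_indicator
        measurable_compose[OF borel_measurable_coordinate assms(2)])
  ultimately show ?thesis
    using nn_integral_lebesgue_Rn_Suc_rev[of "\<lambda>x. indicator (slab c \<phi>) x * g (x m)" m]
    by (simp del: fun_upd_apply)
qed

abbreviation core where "core \<equiv> slab (\<lambda>_. 0) \<rho>"

lemma radius_measurable [measurable]: "\<rho> \<in> borel_measurable borel"
  unfolding radius_def by measurable

lemma core_subset_W: "core \<subseteq> W"
  by (auto simp: slab_def intro!: mem_W_if_radius)

end

section \<open>Volume and first moment of the truncated cone\<close>

locale tapering_wedge = wedge + assumes r_less_b: "r < b"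
begin

text \<open>The height gained per unit of radius lost. The two closed forms that follow come from
  integrating over the radius s = \<open>\<rho> t\<close> in [r, b], with dt = - slope ds and t - p
  = slope (b - s).\<close>

definition slope :: real where "slope = (q - p) / (b - r)"
definition core_volume :: real
  where "core_volume = \<omega> * slope * (b ^ Suc m - r ^ Suc m) / real (Suc m)"
definition core_moment :: real
  where "core_moment = \<omega> * slope\<^sup>2 *
    (b * (b ^ Suc m - r ^ Suc m) / real (Suc m) - (b ^ Suc (Suc m) - r ^ Suc (Suc m)) / real (Suc (Suc m)))"

lemma slope_pos: "slope > 0"
  using pq r_less_b by (simp add: slope_def)

lemma radius_endpoints: "\<rho> p = b" "\<rho> q = r"
  using pq by (auto simp: radius_def)

lemma DERIV_radius: "(\<rho> has_real_derivative (- 1 / slope)) (at t)"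
proof -
  have "((\<lambda>t. ((q - t) * b + (t - p) * r) / (q - p)) has_real_derivative (r - b) / (q - p)) (at t)"
    using pq by (auto intro!: derivative_eq_intros)
  moreover have "(r - b) / (q - p) = - 1 / slope"
    using pq r_less_b by (simp add: slope_def minus_divide_left)
  ultimately show ?thesis unfolding radius_def by simp
qed

lemma diff_eq_slope: "t - p = slope * (b - \<rho> t)"
proof -
  have "b - \<rho> t = (t - p) * ((b - r) / (q - p))"
    using pq by (simp add: radius_def field_simps)
  then show ?thesis using pq r_less_b by (simp add: slope_def)
qed

lemma emeasure_core: "emeasure (lebesgue_Rn (Suc m)) core = ennreal core_volume"
proof -
  define F where "F t = - (\<omega> * slope / real (Suc m)) * \<rho> t ^ Suc m" for t
  have "(\<integral>\<^sup>+t. ennreal (\<rho> t ^ m * \<omega>) * indicator {p..q} t \<partial>lborel) = ennreal (F q - F p)"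
  proof (rule nn_integral_FTC_Icc)
    fix t assume t: "t \<in> {p..q}"
    have "(F has_real_derivative (- (\<omega> * slope / real (Suc m)) * (real (Suc m) * (- 1 / slope * \<rho> t ^ m)))) (at t)"
      unfolding F_def using DERIV_power[OF DERIV_radius, of "Suc m" t] by (intro DERIV_cmult) simp
    also have "- (\<omega> * slope / real (Suc m)) * (real (Suc m) * (- 1 / slope * \<rho> t ^ m)) = \<rho> t ^ m * \<omega>"
      using slope_pos by (simp del: of_nat_Suc)
    finally show "(F has_real_derivative \<rho> t ^ m * \<omega>) (at t)" .
    show "0 \<le> \<rho> t ^ m * \<omega>" using radius_pos[of t] t by simp
  qed (use pq in auto)
  moreover have "F q - F p = core_volume"
    by (simp only: F_def radius_endpoints core_volume_def) (simp add: diff_divide_distrib right_diff_distrib)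
  moreover have "emeasure (lebesgue_Rn (Suc m)) core = (\<integral>\<^sup>+x. indicator core x * 1 \<partial>lebesgue_Rn (Suc m))"
    by simp
  ultimately show ?thesis
    using nn_integral_slab[of \<rho> "\<lambda>_. 1" "\<lambda>_. 0"] radius_pos by simp
qed

lemma nn_integral_core:
  "(\<integral>\<^sup>+x. indicator core x * ennreal (x m - p) \<partial>lebesgue_Rn (Suc m)) = ennreal core_moment"
proof -
  define F where "F t = \<omega> * slope\<^sup>2 * (\<rho> t ^ Suc (Suc m) / real (Suc (Suc m)) - b * \<rho> t ^ Suc m / real (Suc m))" for t
  have "(\<integral>\<^sup>+x. indicator core x * ennreal (x m - p) \<partial>lebesgue_Rn (Suc m))
    = (\<integral>\<^sup>+t. ennreal (t - p) * ennreal (\<rho> t ^ m * \<omega>) * indicator {p..q} t \<partial>lborel)"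
    using radius_pos by (intro nn_integral_slab) auto
  also have "\<dots> = (\<integral>\<^sup>+t. ennreal ((t - p) * (\<rho> t ^ m * \<omega>)) * indicator {p..q} t \<partial>lborel)"
    using radius_pos by (intro nn_integral_cong) (auto simp: indicator_def ennreal_mult less_imp_le)
  also have "\<dots> = ennreal (F q - F p)"
  proof (rule nn_integral_FTC_Icc)
    fix t assume t: "t \<in> {p..q}"
    have P: "((\<lambda>t. \<rho> t ^ Suc k / real (Suc k)) has_real_derivative (- 1 / slope * \<rho> t ^ k)) (at t)" for k
    proof -
      have "((\<lambda>t. \<rho> t ^ Suc k / real (Suc k)) has_real_derivative (real (Suc k) * (- 1 / slope * \<rho> t ^ k) / real (Suc k))) (at t)"
        using DERIV_power[OF DERIV_radius, of "Suc k" t] by (intro DERIV_cdivide) simp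
      then show ?thesis by (simp del: of_nat_Suc)
    qed
    have "((\<lambda>t. \<omega> * slope\<^sup>2 * (\<rho> t ^ Suc (Suc m) / real (Suc (Suc m)) - b * (\<rho> t ^ Suc m / real (Suc m))))
      has_real_derivative (\<omega> * slope\<^sup>2 * ((- 1 / slope * \<rho> t ^ Suc m) - b * (- 1 / slope * \<rho> t ^ m)))) (at t)"
      by (intro DERIV_cmult DERIV_diff P)
    also have "\<omega> * slope\<^sup>2 * ((- 1 / slope * \<rho> t ^ Suc m) - b * (- 1 / slope * \<rho> t ^ m))
      = (slope * (b - \<rho> t)) * (\<rho> t ^ m * \<omega>)"
      using slope_pos by (simp add: power2_eq_square algebra_simps)
    finally show "(F has_real_derivative (t - p) * (\<rho> t ^ m * \<omega>)) (at t)"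
      unfolding F_def diff_eq_slope[symmetric] times_divide_eq_right .
    show "0 \<le> (t - p) * (\<rho> t ^ m * \<omega>)" using radius_pos[of t] t by simp
  qed (use pq in auto)
  also have "F q - F p = core_moment"
    by (simp only: F_def radius_endpoints core_moment_def) (simp add: diff_divide_distrib right_diff_distrib)
  finally show ?thesis .
qed

end

section \<open>The part of the wedge outside the cone\<close>

locale thin_wedge = inscribed_wedge + tapering_wedge
begin

text \<open>A crude bound: each of the 2m cylinders extends over the full height. What matters is
  the radius 1/(2r), whose m-th power competes with that of b.\<close>

definition cap_volume :: real
  where "cap_volume = 2 * real m * (q - p) * \<omega> * (1 / (2 * r)) ^ m"

definition caps :: "(nat \<Rightarrow> real) set"
  where "caps = (\<Union>(i, \<sigma>)\<in>{..<m} \<times> {1, -1}. slab (\<lambda>k. if k = i then \<sigma> / (2 * r) else 0) (\<lambda>_. 1 / (2 * r)))"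

lemma caps_sets [measurable]: "caps \<in> sets borel"
  unfolding caps_def by (intro sets.finite_UN) auto

lemma emeasure_caps: "emeasure (lebesgue_Rn (Suc m)) caps \<le> ennreal cap_volume"
proof -
  let ?S = "\<lambda>(i, \<sigma>). slab (\<lambda>k. if k = i then \<sigma> / (2 * r) else 0) (\<lambda>_. 1 / (2 * r))"
  have "emeasure (lebesgue_Rn (Suc m)) (slab c (\<lambda>_. 1 / (2 * r))) = ennreal ((q - p) * \<omega> * (1 / (2 * r)) ^ m)" for c
  proof -
    have "emeasure (lebesgue_Rn (Suc m)) (slab c (\<lambda>_. 1 / (2 * r))) = (\<integral>\<^sup>+x. indicator (slab c (\<lambda>_. 1 / (2 * r))) x * 1 \<partial>lebesgue_Rn (Suc m))"
      by simp
    also have "\<dots> = (\<integral>\<^sup>+t. 1 * ennreal ((1 / (2 * r)) ^ m * \<omega>) * indicator {p..q} t \<partial>lborel)"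
      using r by (intro nn_integral_slab) auto
    also have "\<dots> = ennreal ((1 / (2 * r)) ^ m * \<omega>) * ennreal (q - p)"
      using pq by (simp add: nn_integral_cmult)
    also have "\<dots> = ennreal ((q - p) * \<omega> * (1 / (2 * r)) ^ m)"
      using pq r by (subst ennreal_mult[symmetric]) (auto simp: mult_ac)
    finally show ?thesis .
  qed
  then have "(\<Sum>k\<in>{..<m} \<times> {1, -1}. emeasure (lebesgue_Rn (Suc m)) (?S k))
      = (\<Sum>k\<in>{..<m} \<times> {1, -1::real}. ennreal ((q - p) * \<omega> * (1 / (2 * r)) ^ m))"
    by (intro sum.cong) auto
  also have "\<dots> = ennreal (\<Sum>k\<in>{..<m} \<times> {1, -1::real}. (q - p) * \<omega> * (1 / (2 * r)) ^ m)"
    using pq r by (subst sum_ennreal) auto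
  also have "(\<Sum>k\<in>{..<m} \<times> {1, -1::real}. (q - p) * \<omega> * (1 / (2 * r)) ^ m) = cap_volume"
    by (simp add: cap_volume_def card_cartesian_product)
  finally have total: "(\<Sum>k\<in>{..<m} \<times> {1, -1}. emeasure (lebesgue_Rn (Suc m)) (?S k)) = ennreal cap_volume" .
  have "?S ` ({..<m} \<times> {1, -1}) \<subseteq> sets (lebesgue_Rn (Suc m))"
    unfolding image_subset_iff using slab_sets[OF borel_measurable_const] by (simp add: split_beta)
  then have "emeasure (lebesgue_Rn (Suc m)) caps \<le> (\<Sum>k\<in>{..<m} \<times> {1, -1}. emeasure (lebesgue_Rn (Suc m)) (?S k))"
    unfolding caps_def by (intro emeasure_subadditive_finite) auto
  then show ?thesis unfolding total .
qed

text \<open>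
  Outside the core a point is so close to some coordinate axis that it lies in the ball of diameter
  \<open>1 / r\<close> that touches the origin and is centred on that axis.
\<close>

lemma W_subset_core_caps: "W \<subseteq> core \<union> caps"
proof
  fix x assume x: "x \<in> W"
  show "x \<in> core \<union> caps"
  proof (cases "L2_set x {..<m} \<le> \<rho> (x m)")
    case True
    then show ?thesis using x by (auto simp: slab_def wedge_body_def)
  next
    case False
    then obtain i where i: "i < m" "r * L2_set x {..<m} < a * \<bar>x i\<bar>"
      using W_dichotomy[OF x] by blast
    have "a\<^sup>2 \<le> 1" using qa by (metis le_add_same_cancel2 zero_le_power2)
    then have "a \<le> 1" using power2_le_imp_le[of a 1] by simp
    then have "a * \<bar>x i\<bar> \<le> \<bar>x i\<bar>" using a by (simp add: mult_left_le_one_le)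
    with i have less: "r * L2_set x {..<m} \<le> \<bar>x i\<bar>" by simp
    have "(L2_set x {..<Suc m})\<^sup>2 \<le> 1"
      using W_subset_unit_ball x power_le_one[of "L2_set x {..<Suc m}" 2]
      by (auto simp: unit_ball_def euclidean_norm_def)
    then have "(L2_set x {..<m})\<^sup>2 \<le> 1" by (simp add: L2_set_Suc_squared) (smt (verit) zero_le_power2)
    then have "L2_set x {..<m} \<le> 1" using power2_le_imp_le[of "L2_set x {..<m}" 1] by simp
    \<comment> \<open>The horizontal part has norm at most 1, so the linear bound by the dominant
      coordinate becomes a quadratic one; completing the square then shows membership in the ball
      around \<sigma>/(2r) on the i-th axis.\<close>
    then have "r * (L2_set x {..<m})\<^sup>2 \<le> r * L2_set x {..<m}"
      using r by (simp add: power2_eq_square mult_left_le)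
    with less have "r * (L2_set x {..<m})\<^sup>2 \<le> \<bar>x i\<bar>" by linarith
    then have sq: "(L2_set x {..<m})\<^sup>2 \<le> \<bar>x i\<bar> / r"
      unfolding pos_le_divide_eq[OF r] by (subst mult.commute)
    define \<sigma> :: real where "\<sigma> = (if x i \<ge> 0 then 1 else -1)"
    define c where "c = (\<lambda>k. if k = i then \<sigma> / (2 * r) else 0)"
    have "(L2_set (\<lambda>k. x k - c k) {..<m})\<^sup>2 = (\<Sum>k<m. (x k)\<^sup>2 - 2 * x k * c k + (c k)\<^sup>2)"
      unfolding sum_mult_self_L2_set[symmetric] by (simp add: power2_eq_square algebra_simps)
    also have "\<dots> = (\<Sum>k<m. (x k)\<^sup>2) + (\<Sum>k<m. if k = i then (c i)\<^sup>2 - 2 * x i * c i else 0)"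
      by (subst sum.distrib[symmetric], intro sum.cong) (auto simp: c_def)
    also have "\<dots> = (L2_set x {..<m})\<^sup>2 + ((c i)\<^sup>2 - 2 * x i * c i)"
      using i(1) by (simp add: L2_set_def sum_nonneg)
    also have "(c i)\<^sup>2 - 2 * x i * c i = (1 / (2 * r))\<^sup>2 - \<bar>x i\<bar> / r"
      using r by (auto simp: c_def \<sigma>_def power_divide)
    also have "(L2_set x {..<m})\<^sup>2 + ((1 / (2 * r))\<^sup>2 - \<bar>x i\<bar> / r) \<le> (1 / (2 * r))\<^sup>2"
      using sq by linarith
    finally have "L2_set (\<lambda>k. x k - c k) {..<m} \<le> 1 / (2 * r)"
      by (rule power2_le_imp_le) (use r in simp)
    then have "x \<in> slab c (\<lambda>_. 1 / (2 * r))" using W_subset_Rn x by (auto simp: slab_def wedge_body_def)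
    moreover have "(i, \<sigma>) \<in> {..<m} \<times> {1, -1}" using i(1) by (simp add: \<sigma>_def)
    ultimately have "x \<in> caps" unfolding caps_def c_def by (intro UN_I[of "(i, \<sigma>)"]) simp_all
    then show ?thesis by blast
  qed
qed

end

section \<open>Centroid and relative distance\<close>

context thin_wedge
begin

definition volume :: real where "volume = measure (lebesgue_Rn (Suc m)) W"
text \<open>Heights are measured from p: the integrand is then nonnegative on the body, and
  inclusions of sets give bounds on the integral.\<close>

definition moment :: real
  where "moment = enn2real (\<integral>\<^sup>+x. indicator W x * ennreal (x m - p) \<partial>lebesgue_Rn (Suc m))"

lemma cap_volume_nonneg: "cap_volume \<ge> 0"
  using pq r by (simp add: cap_volume_def)

lemma core_volume_pos: "core_volume > 0"
proof -
  have "r ^ Suc m < b ^ Suc m" using r r_less_b by (intro power_strict_mono) auto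
  then show ?thesis
    using slope_pos measure_unit_ball_pos[of m] by (simp add: core_volume_def del: power_Suc of_nat_Suc)
qed

text \<open>\<open>nn_integral_core\<close> does not give this, since \<open>ennreal\<close> sends
  negative numbers to 0. The primitive F decreases on [r, b] because its derivative is t^m (t -
  b).\<close>

lemma core_moment_nonneg: "core_moment \<ge> 0"
proof -
  define F where "F t = t ^ Suc (Suc m) / real (Suc (Suc m)) - b * t ^ Suc m / real (Suc m)" for t
  have "F b \<le> F r"
  proof (rule DERIV_nonpos_imp_nonincreasing[of r b F])
    show "r \<le> b" using r_less_b by simp
    fix t assume t: "r \<le> t" "t \<le> b"
    have "((\<lambda>t. t ^ Suc k / real (Suc k)) has_real_derivative t ^ k) (at t)" for k
      using DERIV_cdivide[OF DERIV_power[OF DERIV_ident, of "Suc k" t], of "real (Suc k)"] by (simp del: of_nat_Suc)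
    then have "((\<lambda>t. t ^ Suc (Suc m) / real (Suc (Suc m)) - b * (t ^ Suc m / real (Suc m)))
        has_real_derivative (t ^ Suc m - b * t ^ m)) (at t)"
      by (intro DERIV_diff DERIV_cmult)
    moreover have "t ^ Suc m - b * t ^ m \<le> 0" using t r by (simp add: mult_right_mono)
    ultimately show "\<exists>y. (F has_real_derivative y) (at t) \<and> y \<le> 0"
      unfolding F_def by (auto simp del: power_Suc of_nat_Suc)
  qed
  moreover have "core_moment = \<omega> * slope\<^sup>2 * (F r - F b)"
    by (simp add: core_moment_def F_def diff_divide_distrib right_diff_distrib)
  ultimately show ?thesis by simp
qed

lemma emeasure_W: "emeasure (lebesgue_Rn (Suc m)) W = ennreal volume"
proof -
  have "emeasure (lebesgue_Rn (Suc m)) W \<le> emeasure (lebesgue_Rn (Suc m)) (unit_ball (Suc m))"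
    by (rule emeasure_mono[OF W_subset_unit_ball]) simp
  then have "emeasure (lebesgue_Rn (Suc m)) W \<noteq> \<infinity>"
    using emeasure_unit_ball_finite[of "Suc m"] by (auto simp: top_unique)
  then show ?thesis by (simp add: volume_def emeasure_eq_ennreal_measure)
qed

lemma volume_bounds: "core_volume \<le> volume" "volume \<le> core_volume + cap_volume"
proof -
  have "ennreal core_volume \<le> ennreal volume"
    unfolding emeasure_core[symmetric] emeasure_W[symmetric] by (rule emeasure_mono[OF core_subset_W]) simp
  then show "core_volume \<le> volume" by (simp add: volume_def)
  have "ennreal volume \<le> emeasure (lebesgue_Rn (Suc m)) (core \<union> caps)"
    unfolding emeasure_W[symmetric] using W_subset_core_caps by (intro emeasure_mono) auto
  also have "\<dots> \<le> emeasure (lebesgue_Rn (Suc m)) core + emeasure (lebesgue_Rn (Suc m)) caps"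
    by (rule emeasure_subadditive) auto
  also have "\<dots> \<le> ennreal core_volume + ennreal cap_volume"
    unfolding emeasure_core by (intro add_left_mono emeasure_caps)
  finally show "volume \<le> core_volume + cap_volume"
    using core_volume_pos cap_volume_nonneg by (simp add: ennreal_plus[symmetric] del: ennreal_plus)
qed

lemma nn_integral_W:
  "(\<integral>\<^sup>+x. indicator W x * ennreal (x m - p) \<partial>lebesgue_Rn (Suc m)) \<le> ennreal (core_moment + (q - p) * cap_volume)"
proof -
  have "(\<integral>\<^sup>+x. indicator W x * ennreal (x m - p) \<partial>lebesgue_Rn (Suc m))
    \<le> (\<integral>\<^sup>+x. indicator core x * ennreal (x m - p) + ennreal (q - p) * indicator caps x \<partial>lebesgue_Rn (Suc m))"
  proof (rule nn_integral_mono)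
    fix x
    show "indicator W x * ennreal (x m - p) \<le> indicator core x * ennreal (x m - p) + ennreal (q - p) * indicator caps x"
    proof (cases "x \<in> W \<and> x \<notin> core")
      case True
      then have "x \<in> caps" "x m \<le> q" using W_subset_core_caps by (auto simp: wedge_body_def)
      then show ?thesis using True by (simp add: ennreal_leI)
    qed (auto simp: indicator_def)
  qed
  also have "\<dots> = ennreal core_moment + ennreal (q - p) * emeasure (lebesgue_Rn (Suc m)) caps"
    by (subst nn_integral_add) (auto simp: nn_integral_core nn_integral_cmult)
  also have "\<dots> \<le> ennreal core_moment + ennreal (q - p) * ennreal cap_volume"
    by (intro add_left_mono mult_left_mono emeasure_caps) simp
  also have "\<dots> = ennreal (core_moment + (q - p) * cap_volume)"
    using core_moment_nonneg cap_volume_nonneg pq by (simp add: ennreal_mult)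
  finally show ?thesis .
qed

lemma moment_bounds: "core_moment \<le> moment" "moment \<le> core_moment + (q - p) * cap_volume"
proof -
  let ?J = "\<integral>\<^sup>+x. indicator W x * ennreal (x m - p) \<partial>lebesgue_Rn (Suc m)"
  have fin: "?J < \<infinity>" using nn_integral_W by (rule le_less_trans) simp
  have J: "?J = ennreal moment" using fin by (simp add: moment_def)
  have "ennreal core_moment \<le> ?J"
    unfolding nn_integral_core[symmetric] using core_subset_W
    by (intro nn_integral_mono mult_right_mono) (auto simp: indicator_def)
  then show "core_moment \<le> moment" unfolding J by (simp add: moment_def)
  show "moment \<le> core_moment + (q - p) * cap_volume"
  proof -
    have "0 \<le> core_moment + (q - p) * cap_volume"
      using core_moment_nonneg cap_volume_nonneg pq by simp
    then show ?thesis using nn_integral_W unfolding J by (simp only: ennreal_le_iff)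
  qed
qed

lemma integral_axis: "(LINT x:W|lebesgue_Rn (Suc m). x m) = moment + p * volume"
proof -
  let ?L = "lebesgue_Rn (Suc m)"
  let ?f = "\<lambda>x. indicator W x * (x m - p)"
  have f: "?f \<in> borel_measurable ?L" by measurable
  have nonneg: "0 \<le> ?f x" for x by (auto simp: indicator_def wedge_body_def)
  have ef: "ennreal (?f x) = indicator W x * ennreal (x m - p)" for x by (auto simp: indicator_def)
  have fin: "(\<integral>\<^sup>+x. ennreal (?f x) \<partial>?L) < \<infinity>"
    unfolding ef using nn_integral_W by (rule le_less_trans) simp
  have int: "integrable ?L ?f" using f fin nonneg by (intro integrableI_nonneg) auto
  have W: "integrable ?L (indicator W :: _ \<Rightarrow> real)"
    by (rule integrable_real_indicator) (auto simp: emeasure_W)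
  have "(LINT x:W|?L. x m) = (LINT x|?L. ?f x + p * indicator W x)"
    unfolding set_lebesgue_integral_def by (intro Bochner_Integration.integral_cong) (auto simp: indicator_def)
  also have "\<dots> = (LINT x|?L. ?f x) + p * measure ?L W"
    using int W by simp
  also have "(LINT x|?L. ?f x) = moment"
    unfolding moment_def ef[symmetric] using f nonneg by (intro integral_eq_nn_integral) auto
  finally show ?thesis by (simp add: volume_def)
qed

lemma volume_pos: "volume > 0"
  using core_volume_pos volume_bounds(1) by simp

lemma centroid_W: "centroid (Suc m) W = (\<lambda>i. if i = m then p + moment / volume else 0)"
proof
  fix i
  have eq: "centroid (Suc m) W i = (LINT x:W|lebesgue_Rn (Suc m). x i) / volume"
    by (simp add: centroid_def scaleR_fun_def volume_def)
  consider "i = m" | "i < m" | "i > m" by linarith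
  then show "centroid (Suc m) W i = (if i = m then p + moment / volume else 0)"
  proof cases
    case 1
    then show ?thesis unfolding eq using volume_pos by (simp add: integral_axis field_simps)
  next
    case 2
    then show ?thesis unfolding eq by (simp add: integral_coordinate_reflection_symmetric reflect_W)
  next
    case 3
    then have "(\<lambda>x. indicator W x *\<^sub>R x i) = (\<lambda>_. 0)"
      by (auto simp: fun_eq_iff indicator_def wedge_body_def topspace_Euclidean_space)
    then show ?thesis unfolding eq set_lebesgue_integral_def using 3 by (simp only:) simp
  qed
qed

lemma axis_mem_W: "(\<lambda>i. if i = m then t else 0) \<in> W \<longleftrightarrow> p \<le> t \<and> t \<le> q"
proof
  assume "p \<le> t \<and> t \<le> q"
  then show "(\<lambda>i. if i = m then t else 0) \<in> W"
    using radius_pos[of t] by (intro mem_W_if_radius) (auto simp: topspace_Euclidean_space L2_set_def)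
qed (auto simp: wedge_body_def)

text \<open>Both centers lie on the axis, so the chord through them is the axis segment between the
  heights p and q.\<close>

lemma rel_dist_W: "rel_dist (Suc m) W (centroid (Suc m) W) (loewner_center (Suc m) W)
    = \<bar>p + moment / volume\<bar> / (q - p)"
proof -
  define \<gamma> where "\<gamma> = p + moment / volume"
  define g where "g = (\<lambda>i. if i = m then \<gamma> else 0)"
  have g: "centroid (Suc m) W = g" by (simp only: centroid_W g_def \<gamma>_def)
  show ?thesis
  \<comment> \<open>If the two centers coincide, the distance is 0 by definition, and so is the
    right-hand side.\<close>
  proof (cases "\<gamma> = 0")
    case True
    then have "g = 0" by (auto simp: g_def fun_eq_iff)
    then show ?thesis using True by (simp add: rel_dist_def g loewner_center_W \<gamma>_def)
  next
    case False
    then have g0: "g \<noteq> 0" by (auto simp: g_def fun_eq_iff)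
    have L2: "L2_set (\<lambda>i. if i = m then c else 0) {..<Suc m} = \<bar>c\<bar>" for c :: real
      by (simp add: L2_set_def if_distrib[where f="\<lambda>t. t\<^sup>2"] cong: if_cong)
    have norm: "euclidean_norm (Suc m) (g - 0) = \<bar>\<gamma>\<bar>" "euclidean_norm (Suc m) (0 - g) = \<bar>\<gamma>\<bar>"
    proof -
      have "g - 0 = (\<lambda>i. if i = m then \<gamma> else 0)" "0 - g = (\<lambda>i. if i = m then - \<gamma> else 0)"
        by (auto simp: g_def fun_eq_iff)
      then show "euclidean_norm (Suc m) (g - 0) = \<bar>\<gamma>\<bar>" "euclidean_norm (Suc m) (0 - g) = \<bar>\<gamma>\<bar>"
        unfolding euclidean_norm_def by (simp_all only: L2 abs_minus_cancel)
    qed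
    \<comment> \<open>Arc length runs from the centroid towards 0, that is, against the sign of its
      height.\<close>
    have point: "g + (t / \<bar>\<gamma>\<bar>) *\<^sub>R (0 - g) = (\<lambda>i. if i = m then \<gamma> - t * sgn \<gamma> else 0)" for t
      using False by (auto simp: fun_eq_iff g_def scaleR_fun_def sgn_if)
    have aff: "g + c *\<^sub>R (0 - g) \<in> affine hull {g, 0}" for c
    proof -
      have "g + c *\<^sub>R (0 - g) = (1 - c) *\<^sub>R g + c *\<^sub>R 0" by (simp add: algebra_simps)
      then show ?thesis unfolding affine_hull_2 by fastforce
    qed
    have "g + (t / \<bar>\<gamma>\<bar>) *\<^sub>R (0 - g) \<in> affine hull {g, 0} \<inter> W \<longleftrightarrow> p \<le> \<gamma> - t * sgn \<gamma> \<and> \<gamma> - t * sgn \<gamma> \<le> q" for t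
      unfolding Int_iff axis_mem_W[symmetric] point[symmetric] using aff by blast
    then have "{t. g + (t / \<bar>\<gamma>\<bar>) *\<^sub>R (0 - g) \<in> affine hull {g, 0} \<inter> W} = {t. p \<le> \<gamma> - t * sgn \<gamma> \<and> \<gamma> - t * sgn \<gamma> \<le> q}"
      by (rule Collect_cong)
    also have "\<dots> = (if \<gamma> > 0 then {\<gamma> - q..\<gamma> - p} else {p - \<gamma>..q - \<gamma>})"
      using False by (auto simp: sgn_if)
    finally have "length_on_line (Suc m) g 0 (affine hull {g, 0} \<inter> W) = q - p"
      unfolding length_on_line_def norm using pq by simp
    then show ?thesis
      using g0 by (simp add: rel_dist_def g loewner_center_W norm[simplified] \<gamma>_def[symmetric])
  qed
qed

definition core_mean :: real where "core_mean = core_moment / (core_volume * (q - p))"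
definition cap_ratio :: real where "cap_ratio = cap_volume / core_volume"

text \<open>For the lower bound the caps count fully in the volume and not in the moment; for the
  upper bound they count at height q in the moment and not in the volume.\<close>

lemma relative_mean_bounds:
  "core_mean / (1 + cap_ratio) \<le> moment / volume / (q - p)"
  "moment / volume / (q - p) \<le> core_mean + cap_ratio"
proof -
  have "core_moment / (core_volume + cap_volume) \<le> moment / volume"
    using volume_bounds moment_bounds core_moment_nonneg volume_pos by (intro frac_le) auto
  then have "core_moment / (core_volume + cap_volume) / (q - p) \<le> moment / volume / (q - p)"
    using pq by (intro divide_right_mono) auto
  moreover have "core_volume + cap_volume = core_volume * (1 + cap_ratio)"
    using core_volume_pos by (simp add: cap_ratio_def distrib_left)
  ultimately show "core_mean / (1 + cap_ratio) \<le> moment / volume / (q - p)"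
    by (simp add: core_mean_def mult_ac)
  have "moment / volume \<le> (core_moment + (q - p) * cap_volume) / core_volume"
    using volume_bounds moment_bounds core_moment_nonneg core_volume_pos cap_volume_nonneg pq by (intro frac_le) auto
  then have "moment / volume / (q - p) \<le> (core_moment + (q - p) * cap_volume) / core_volume / (q - p)"
    using pq by (intro divide_right_mono) auto
  also have "\<dots> = core_mean + cap_ratio"
    using pq core_volume_pos by (simp add: core_mean_def cap_ratio_def add_divide_distrib)
  finally show "moment / volume / (q - p) \<le> core_mean + cap_ratio" .
qed

lemma cap_ratio_nonneg: "cap_ratio \<ge> 0"
  using cap_volume_nonneg core_volume_pos by (simp add: cap_ratio_def)

text \<open>This form isolates the leading term; the remainder is of the order of
  (r/b)^(m+1).\<close>

lemma core_mean_eq: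
  "core_mean = b / ((b - r) * real (Suc (Suc m)))
    - real (Suc m) / real (Suc (Suc m)) * (r ^ Suc m / (b ^ Suc m - r ^ Suc m))"
proof -
  define X where "X = b ^ Suc m - r ^ Suc m"
  define R where "R = r ^ Suc m"
  define k l where "k = real (Suc m)" and "l = real (Suc (Suc m))"
  have pos: "X > 0" "k > 0" "l > 0" "b - r > 0" "slope > 0" "\<omega> > 0" "q - p > 0"
    using r r_less_b slope_pos measure_unit_ball_pos[of m] pq
    by (auto simp: X_def k_def l_def intro!: power_strict_mono simp del: power_Suc)
  have Y: "b ^ Suc (Suc m) - r ^ Suc (Suc m) = b * X + (b - r) * R"
    by (simp add: X_def R_def algebra_simps)
  have l: "l = k + 1" by (simp add: l_def k_def)
  have "core_mean = \<omega> * slope\<^sup>2 * (b * X / k - (b * X + (b - r) * R) / l) / (\<omega> * slope * X / k * (q - p))"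
    unfolding core_mean_def core_moment_def core_volume_def Y unfolding X_def k_def l_def ..
  also have "\<dots> = (slope / (q - p)) * ((b * X / k - (b * X + (b - r) * R) / l) / (X / k))"
    using pos by (simp add: power2_eq_square)
  also have "slope / (q - p) = 1 / (b - r)"
    using pos by (simp add: slope_def)
  also have "(b * X / k - (b * X + (b - r) * R) / l) / (X / k) = b - k / l * (b + (b - r) * (R / X))"
  proof -
    have "(b * X / k - X * Z / l) / (X / k) = b - k / l * Z" for Z
      using pos by (simp add: field_simps)
    moreover have "b * X + (b - r) * R = X * (b + (b - r) * (R / X))"
      using pos by (simp add: distrib_left)
    ultimately show ?thesis by (simp only:)
  qed
  also have "\<dots> = b / l - (b - r) * (k / l * (R / X))"
  proof -
    have "b - k / l * b = b / l" using pos unfolding l by (simp add: field_simps)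
    then show ?thesis by (simp add: distrib_left mult_ac)
  qed
  also have "1 / (b - r) * (b / l - (b - r) * (k / l * (R / X))) = b / ((b - r) * l) - k / l * (R / X)"
    using pos by (simp add: right_diff_distrib)
  finally show ?thesis by (simp add: X_def R_def k_def l_def)
qed

text \<open>The volume \<omega> and the height q - p cancel, so no asymptotics of ball volumes
  enters.\<close>

lemma cap_ratio_eq:
  "cap_ratio = 2 * real m * real (Suc m) * (b - r) * (1 / (2 * r)) ^ m / (b ^ Suc m - r ^ Suc m)"
proof -
  define X where "X = b ^ Suc m - r ^ Suc m"
  have pos: "X > 0" "b - r > 0" "\<omega> > 0" "q - p > 0"
    using r r_less_b measure_unit_ball_pos[of m] pq
    by (auto simp: X_def intro!: power_strict_mono simp del: power_Suc)
  have "cap_ratio = (2 * real m * (q - p) * \<omega> * (1 / (2 * r)) ^ m) / (\<omega> * ((q - p) / (b - r)) * X / real (Suc m))"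
    unfolding cap_ratio_def cap_volume_def core_volume_def slope_def X_def ..
  also have "\<dots> = 2 * real m * real (Suc m) * (b - r) * (1 / (2 * r)) ^ m / X"
  proof -
    have "(A * (q - p) * \<omega> * B) / (\<omega> * ((q - p) / c) * X / k) = A * k * c * B / X"
      if "c > 0" "k > 0" for A B c k
      using that pos(1,3,4) by simp
    then show ?thesis using pos(2) by (simp only: of_nat_0_less_iff zero_less_Suc)
  qed
  finally show ?thesis by (simp add: X_def)
qed

end

section \<open>Asymptotics\<close>

definition center_const :: real where "center_const = 4 + 2 * exp 1 / ((exp 1 - 1) * (1 - sqrt (2 / pi)))"
text \<open>The value that 1/(1 - r/b) has to take: 25/9 is the limit of n q/(q - p). Solving for r
  gives \<open>neck\<close>.\<close>

definition taper :: real where "taper = center_const - 25 / 9"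

text \<open>The threshold is equivalent to \<open>neck\<close> > 5/8, that is, to 2rb > 1 with b =
  4/5. It suffices that sqrt (2 / pi) lies in [1/2, 1), which makes \<open>center_const\<close> at
  least 8.\<close>

lemma taper_gt: "taper > 32 / 7"
proof -
  have "1 / 4 \<le> 2 / pi" using pi_less_4 by (simp add: le_divide_eq)
  then have "sqrt (1 / 4) \<le> sqrt (2 / pi)" by (rule real_sqrt_le_mono)
  then have ge: "1 / 2 \<le> sqrt (2 / pi)" by (simp add: real_sqrt_divide)
  have "2 / pi < 1" using pi_gt3 by simp
  then have lt: "sqrt (2 / pi) < 1" by simp
  have e: "exp 1 > (1::real)" by simp
  have "(exp 1 - 1) * (1 - sqrt (2 / pi)) \<le> (exp 1 - 1) * (1 / 2 :: real)"
    using ge e by (intro mult_left_mono) auto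
  also have "\<dots> \<le> exp 1 / 2" by simp
  finally have "4 * ((exp 1 - 1) * (1 - sqrt (2 / pi))) \<le> 2 * exp 1" by simp
  moreover have "(exp 1 - 1) * (1 - sqrt (2 / pi)) > 0" using lt e by simp
  ultimately have "4 \<le> 2 * exp 1 / ((exp 1 - 1) * (1 - sqrt (2 / pi)))"
    by (simp add: le_divide_eq)
  then show ?thesis by (simp add: taper_def center_const_def)
qed

definition tip :: "nat \<Rightarrow> real" where "tip m = 5 / (3 * real (Suc m))"
text \<open>The absolute value matters only for m = 0, where the tip is at height 5/3. It keeps the
  radius positive there, so that the body is a convex body in dimension 1 too.\<close>

definition tip_radius :: "nat \<Rightarrow> real" where "tip_radius m = sqrt \<bar>1 - (tip m)\<^sup>2\<bar>"
definition neck :: real where "neck = 4 / 5 * (1 - 1 / taper)"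
definition body :: "nat \<Rightarrow> (nat \<Rightarrow> real) set"
  where "body m = wedge_body m (tip_radius m) (4 / 5) neck (- (3 / 5)) (tip m)"

lemma neck_bounds: "0 < neck" "neck < 4 / 5" "5 / 8 < neck"
proof -
  have "1 / taper < 7 / 32" using taper_gt by (simp add: divide_less_eq)
  then show "5 / 8 < neck" "0 < neck" by (auto simp: neck_def)
  show "neck < 4 / 5" using taper_gt by (simp add: neck_def)
qed

lemma tip_pos: "tip m > 0" by (simp add: tip_def)

lemma wedge_parameters: "wedge (tip_radius m) (4 / 5) neck (- (3 / 5)) (tip m)"
proof
  \<comment> \<open>The radius a would vanish at tip height 1, but 5 is not a multiple of 3.\<close>
  have "tip m \<noteq> 1"
  proof
    assume "tip m = 1"
    then have "real 5 = real (3 * Suc m)" by (simp add: tip_def)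
    then have "5 = 3 * Suc m" by (simp only: of_nat_eq_iff)
    then show False by presburger
  qed
  then have "(tip m)\<^sup>2 \<noteq> 1" using tip_pos[of m] by (simp add: power2_eq_1_iff)
  then show "0 < tip_radius m" by (simp add: tip_radius_def)
qed (use neck_bounds tip_pos[of m] in auto)

text \<open>From m = 2 on the tip is at most 5/9, whence a >= 4/5 > r. For m = 1 already a < 5/8 <
  r, and for m = 0 the tip lies outside the unit ball.\<close>

lemma thin_wedge_parameters:
  assumes m: "m \<ge> 2"
  shows "thin_wedge m (tip_radius m) (4 / 5) neck (- (3 / 5)) (tip m)"
proof -
  interpret wedge m "tip_radius m" "4 / 5" neck "- (3 / 5)" "tip m" by (rule wedge_parameters)
  have "tip m \<le> 5 / 9" using m by (simp add: tip_def divide_le_eq)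
  then have "(tip m)\<^sup>2 \<le> (5 / 9)\<^sup>2" using tip_pos[of m] by (intro power_mono) auto
  also have "(5 / 9)\<^sup>2 \<le> (9 / 25 :: real)" by (simp add: power2_eq_square)
  finally have t: "(tip m)\<^sup>2 \<le> 9 / 25" .
  have "sqrt ((4 / 5)\<^sup>2) \<le> tip_radius m"
    unfolding tip_radius_def using t by (intro real_sqrt_le_mono) (simp add: power2_eq_square)
  then have a: "4 / 5 \<le> tip_radius m" by simp
  show ?thesis
  proof
    show "neck \<le> tip_radius m" using a neck_bounds by simp
    show "(- (3 / 5))\<^sup>2 + (4 / 5)\<^sup>2 = (1::real)" by (simp add: power2_eq_square)
    show "(tip m)\<^sup>2 + (tip_radius m)\<^sup>2 = 1" using t by (simp add: tip_radius_def)
    show "- (- (3 / 5)) * tip m * real (Suc m) = 1" by (simp add: tip_def)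
  qed (use m neck_bounds tip_pos in auto)
qed

section \<open>Estimates in terms of the dimension and their limits\<close>

definition mean_approx :: "nat \<Rightarrow> real"
  where "mean_approx m = 1 / real (Suc (Suc m)) * taper
    - real (Suc m) / real (Suc (Suc m)) * ((1 - 1 / taper) ^ Suc m / (1 - (1 - 1 / taper) ^ Suc m))"
text \<open>This is \<open>cap_ratio\<close> for the chosen parameters; the base 5 / (8 * neck) is
  1/(2rb), below 1 by \<open>neck_bounds\<close>.\<close>

definition mean_error :: "nat \<Rightarrow> real"
  where "mean_error m = 2 * real m * real (Suc m) * (1 / taper) * (5 / (8 * neck)) ^ m / (1 - (1 - 1 / taper) ^ Suc m)"

text \<open>Carries the geometry over to sequences: x is the relative height of the centroid above
  the lower end, and the subtracted fraction is that of the Loewner center.\<close>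

lemma rel_dist_body:
  assumes m: "m \<ge> 2"
  obtains x where "rel_dist (Suc m) (body m) (centroid (Suc m) (body m)) (loewner_center (Suc m) (body m))
      = \<bar>x - (3 / 5) / (tip m + 3 / 5)\<bar>"
    and "mean_approx m / (1 + mean_error m) \<le> x" "x \<le> mean_approx m + mean_error m"
    and "mean_error m \<ge> 0"
proof -
  interpret thin_wedge m "tip_radius m" "4 / 5" neck "- (3 / 5)" "tip m" by (rule thin_wedge_parameters[OF m])
  define t where "t = 1 - 1 / taper"
  have taper: "taper > 0" using taper_gt by simp
  have neck: "neck = 4 / 5 * t" "4 / 5 - neck = 4 / 5 * (1 / taper)"
    using taper by (simp_all add: neck_def t_def field_simps)
  have pow: "neck ^ k = (4 / 5) ^ k * t ^ k" "(4 / 5) ^ k - neck ^ k = (4 / 5) ^ k * (1 - t ^ k)" for k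
    unfolding neck(1) power_mult_distrib by (simp_all add: right_diff_distrib)
  have pos: "(4 / 5 :: real) ^ k > 0" for k by simp
  have "core_mean = mean_approx m"
    unfolding core_mean_eq mean_approx_def t_def[symmetric] neck(2) pow(2) unfolding pow(1)
    using pos[of "Suc m"] by (simp del: power_Suc of_nat_Suc)
  moreover have "cap_ratio = mean_error m"
  proof -
    have "(5 / (8 * neck)) ^ m = (1 / (2 * neck)) ^ m * (5 / 4) ^ m"
      by (subst power_mult_distrib[symmetric]) simp
    \<comment> \<open>The denominator contains b to the power m + 1; the surplus factor b cancels
      against the one in b - r.\<close>
    moreover have "(4 / 5 :: real) * (1 / (4 / 5) ^ Suc m) = (5 / 4) ^ m"
      by (simp add: power_divide)
    ultimately have e: "(5 / (8 * neck)) ^ m = (1 / (2 * neck)) ^ m * (4 / 5 * (1 / (4 / 5) ^ Suc m))"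
      by simp
    show ?thesis
      unfolding cap_ratio_eq mean_error_def t_def[symmetric] neck(2) pow(2) e by (simp add: mult_ac del: power_Suc of_nat_Suc)
  qed
  moreover have "\<bar>- (3 / 5) + moment / volume\<bar> / (tip m - - (3 / 5)) = \<bar>moment / volume / (tip m - - (3 / 5)) - (3 / 5) / (tip m + 3 / 5)\<bar>"
  proof -
    have "\<bar>u\<bar> / h = \<bar>u / h\<bar>" if "h > 0" for u h :: real using that by simp
    then have "\<bar>- (3 / 5) + moment / volume\<bar> / (tip m - - (3 / 5)) = \<bar>(- (3 / 5) + moment / volume) / (tip m - - (3 / 5))\<bar>"
      using pq by simp
    then show ?thesis by (simp add: add_divide_distrib diff_divide_distrib)
  qed
  ultimately show ?thesis
    using that[of "moment / volume / (tip m - - (3 / 5))"] rel_dist_W relative_mean_bounds cap_ratio_nonneg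
    by (simp only: body_def)
qed

lemma taper_bounds: "0 < 1 - 1 / taper" "1 - 1 / taper < 1" "0 < 1 / taper"
  using taper_gt by auto

text \<open>The scaled limit serves the upper bound, where the error is added and must be o(1/n);
  the plain one serves the lower bound, where it only enters the factor 1 +
  \<open>mean_error m\<close>.\<close>

lemma mean_error_tendsto: "(\<lambda>m. real (Suc m) * mean_error m) \<longlonglongrightarrow> 0" "mean_error \<longlonglongrightarrow> 0"
proof -
  define t k C where "t = 1 - 1 / taper" and "k = 5 / (8 * neck)" and "C = 1 / taper"
  have *: "0 < t" "t < 1" "0 < k" "k < 1" "0 < C"
    using taper_bounds neck_bounds by (auto simp: t_def k_def C_def)
  have eq: "mean_error m = 2 * real m * real (Suc m) * C * k ^ m * (1 / (1 - t ^ Suc m))" for m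
    by (simp add: mean_error_def t_def k_def C_def)
  have t: "(\<lambda>m. 1 / (1 - t ^ Suc m)) \<longlonglongrightarrow> 1"
    using * by real_asymp
  have "(\<lambda>m. real (Suc m) * (2 * real m * real (Suc m) * C * k ^ m)) \<longlonglongrightarrow> 0"
    using * by real_asymp
  from tendsto_mult[OF this t] show "(\<lambda>m. real (Suc m) * mean_error m) \<longlonglongrightarrow> 0"
    unfolding eq by (simp only: mult.assoc mult_zero_left)
  have "(\<lambda>m. 2 * real m * real (Suc m) * C * k ^ m) \<longlonglongrightarrow> 0"
    using * by real_asymp
  from tendsto_mult[OF this t] show "mean_error \<longlonglongrightarrow> 0"
    unfolding eq[abs_def] by (simp only: mult.assoc mult_zero_left)
qed

lemma mean_approx_tendsto: "(\<lambda>m. real (Suc m) * mean_approx m) \<longlonglongrightarrow> taper"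
proof -
  define t where "t = 1 - 1 / taper"
  have *: "0 < t" "t < 1" using taper_bounds by (auto simp: t_def)
  have "(\<lambda>m. real (Suc m) * (1 / real (Suc (Suc m)) * D - real (Suc m) / real (Suc (Suc m)) * (t ^ Suc m / (1 - t ^ Suc m)))) \<longlonglongrightarrow> D" for D
    using * by real_asymp
  then show ?thesis unfolding mean_approx_def t_def .
qed

lemma rel_dist_body_tendsto:
  "(\<lambda>m. real (Suc m) * (1 - rel_dist (Suc m) (body m) (centroid (Suc m) (body m)) (loewner_center (Suc m) (body m))))
    \<longlonglongrightarrow> center_const" (is "(\<lambda>m. real (Suc m) * (1 - ?d m)) \<longlonglongrightarrow> _")
proof -
  have "\<exists>x. \<forall>m\<ge>2. ?d m = \<bar>x m - (3 / 5) / (tip m + 3 / 5)\<bar> \<and> mean_error m \<ge> 0 \<and>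
    mean_approx m / (1 + mean_error m) \<le> x m \<and> x m \<le> mean_approx m + mean_error m"
    by (rule choice[where Q="\<lambda>m x. m \<ge> 2 \<longrightarrow> ?d m = \<bar>x - (3 / 5) / (tip m + 3 / 5)\<bar> \<and> mean_error m \<ge> 0 \<and>
      mean_approx m / (1 + mean_error m) \<le> x \<and> x \<le> mean_approx m + mean_error m", THEN exE])
      (meson rel_dist_body, blast)
  then obtain x where x: "\<And>m. m \<ge> 2 \<Longrightarrow> ?d m = \<bar>x m - (3 / 5) / (tip m + 3 / 5)\<bar>"
    "\<And>m. m \<ge> 2 \<Longrightarrow> mean_approx m / (1 + mean_error m) \<le> x m"
    "\<And>m. m \<ge> 2 \<Longrightarrow> x m \<le> mean_approx m + mean_error m" by blast
  have nx: "(\<lambda>m. real (Suc m) * x m) \<longlonglongrightarrow> taper"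
  proof (rule tendsto_sandwich)
    show "\<forall>\<^sub>F m in sequentially. real (Suc m) * mean_approx m / (1 + mean_error m) \<le> real (Suc m) * x m"
      using eventually_ge_at_top[of 2]
      by eventually_elim (use x(2) in \<open>auto simp: times_divide_eq_right[symmetric] simp del: times_divide_eq_right of_nat_Suc intro!: mult_left_mono\<close>)
    show "\<forall>\<^sub>F m in sequentially. real (Suc m) * x m \<le> real (Suc m) * mean_approx m + real (Suc m) * mean_error m"
      using eventually_ge_at_top[of 2]
      by eventually_elim (use x(3) in \<open>auto simp: distrib_left[symmetric] simp del: of_nat_Suc intro!: mult_left_mono\<close>)
    show "(\<lambda>m. real (Suc m) * mean_approx m / (1 + mean_error m)) \<longlonglongrightarrow> taper"
      using tendsto_divide[OF mean_approx_tendsto tendsto_add[OF tendsto_const[of 1] mean_error_tendsto(2)]] by simp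
    show "(\<lambda>m. real (Suc m) * mean_approx m + real (Suc m) * mean_error m) \<longlonglongrightarrow> taper"
      using tendsto_add[OF mean_approx_tendsto mean_error_tendsto(1)] by simp
  qed
  have "(\<lambda>m. real (Suc m) * x m * (1 / real (Suc m))) \<longlonglongrightarrow> taper * 0"
    by (intro tendsto_mult nx) real_asymp
  then have x0: "x \<longlonglongrightarrow> 0" by (simp del: of_nat_Suc)
  have "(\<lambda>m. (3 / 5) / (tip m + 3 / 5)) \<longlonglongrightarrow> 1" unfolding tip_def by real_asymp
  then have "(\<lambda>m. x m - (3 / 5) / (tip m + 3 / 5)) \<longlonglongrightarrow> 0 - 1" by (intro tendsto_diff x0)
  \<comment> \<open>The relative heights of centroid and center tend to 0 and 1, so the centroid is
    eventually the lower of the two; this resolves the absolute value.\<close>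
  then have neg: "\<forall>\<^sub>F m in sequentially. x m - (3 / 5) / (tip m + 3 / 5) < 0"
    by (rule order_tendstoD) simp
  have "(\<lambda>m. real (Suc m) * (tip m / (tip m + 3 / 5))) \<longlonglongrightarrow> 25 / 9" unfolding tip_def by real_asymp
  from tendsto_add[OF this nx]
  have "(\<lambda>m. real (Suc m) * (tip m / (tip m + 3 / 5)) + real (Suc m) * x m) \<longlonglongrightarrow> center_const"
    by (simp add: taper_def)
  moreover have "\<forall>\<^sub>F m in sequentially. real (Suc m) * (tip m / (tip m + 3 / 5)) + real (Suc m) * x m = real (Suc m) * (1 - ?d m)"
    using neg eventually_ge_at_top[of 2]
  proof eventually_elim
    case (elim m)
    have "1 = tip m / (tip m + 3 / 5) + (3 / 5) / (tip m + 3 / 5)"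
    proof -
      have "tip m + 3 / 5 \<noteq> 0" using tip_pos[of m] by linarith
      then show ?thesis by (metis add_divide_distrib divide_self)
    qed
    moreover have "?d m = (3 / 5) / (tip m + 3 / 5) - x m" using x(1)[of m] elim by linarith
    ultimately have "1 - ?d m = tip m / (tip m + 3 / 5) + x m" by linarith
    then show ?case by (simp only: distrib_left)
  qed
  ultimately show ?thesis by (rule Lim_transform_eventually)
qed

theorem mainTheorem3:
  shows "\<exists>W :: nat \<Rightarrow> (nat \<Rightarrow> real) set.
    (\<forall>n\<ge>1. W n \<in> convex_bodies n) \<and>
    (\<lambda>n. rel_dist n (W n) (centroid n (W n)) (loewner_center n (W n))
         - (1 - 1 / real n * (4 + 2 * exp 1 / ((exp 1 - 1) * (1 - sqrt (2 / pi))))))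
      \<in> o(\<lambda>n. 1 / real n)"
\<comment> \<open>The body with parameter m lives in dimension n = m + 1. At n = 0 the truncated
  subtraction gives a junk value, which neither the condition n >= 1 nor the limit sees.\<close>
proof (intro exI[of _ "\<lambda>n. body (n - 1)"] conjI allI impI)
  fix n :: nat assume "n \<ge> 1"
  then obtain m where n: "n = Suc m" by (cases n) auto
  interpret wedge m "tip_radius m" "4 / 5" neck "- (3 / 5)" "tip m" by (rule wedge_parameters)
  show "body (n - 1) \<in> convex_bodies n" using W_convex_body by (simp add: n body_def)
next
  let ?d = "\<lambda>n. rel_dist n (body (n - 1)) (centroid n (body (n - 1))) (loewner_center n (body (n - 1)))"
  let ?f = "\<lambda>n. (?d n - (1 - 1 / real n * center_const)) / (1 / real n)"
  have "(\<lambda>m. center_const - real (Suc m) * (1 - ?d (Suc m))) \<longlonglongrightarrow> center_const - center_const"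
    using rel_dist_body_tendsto by (intro tendsto_diff tendsto_const) simp
  moreover have "?f (Suc m) = center_const - real (Suc m) * (1 - ?d (Suc m))" for m
  proof -
    have "(d - (1 - 1 / k * C)) / (1 / k) = C - k * (1 - d)" if "k > 0" for d k C :: real
      using that by (simp add: field_simps)
    then show ?thesis by (simp del: of_nat_Suc)
  qed
  ultimately have "(\<lambda>m. ?f (Suc m)) \<longlonglongrightarrow> 0" by (simp only:) simp
  then have "?f \<longlonglongrightarrow> 0" by (rule LIMSEQ_imp_Suc)
  then have "(\<lambda>n. ?d n - (1 - 1 / real n * center_const)) \<in> o(\<lambda>n. 1 / real n)"
    by (rule smalloI_tendsto) (auto intro: eventually_mono[OF eventually_gt_at_top[of 0]])
  then show "(\<lambda>n. ?d n - (1 - 1 / real n * (4 + 2 * exp 1 / ((exp 1 - 1) * (1 - sqrt (2 / pi))))))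
      \<in> o(\<lambda>n. 1 / real n)"
    unfolding center_const_def .
qed

end
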